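(* Let $f:\{0,1\}^n\to\{0,1\}$ have alternation number $\operatorname{alt}(f)=k$. Then \[bs(f)\le O\!\left(k\max\{\mathsf N(f)^2,\mathsf N(\overline f)^2\}\right).\]
   Context: $\mathsf N(f)$ is the minimum degree of a real polynomial $p$ with $|p(x)|\le1/3$ whenever $f(x)=0$ and $|p(x)|\ge1$ whenever $f(x)=1$; $\overline f=1-f$. A monotone path is a sequence in $\{0,1\}^n$ where each next point is obtained by changing one coordinate from $0$ to $1$; its alternation number is the number of consecutive pairs on which $f$ changes value. $\operatorname{alt}(f)$ is the maximum alternation number over monotone paths from $0^n$ to $1^n$. $bs(f)$ is block sensitivity. Constants in $O(\cdot)$ are absolute. *)

theory Defs
  imports Complex_Main
begin

text \<open>Points of the Boolean cube {0,1}^n are bool lists of length n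
  (True = 1, False = 0).  A Boolean function on {0,1}^n is f :: bool list => bool;
  only its values on lists of length n matter.\<close>

definition cube :: "nat \<Rightarrow> bool list set" where
  "cube n = {x. length x = n}"

definition poly_deg_le :: "nat \<Rightarrow> nat \<Rightarrow> (bool list \<Rightarrow> real) \<Rightarrow> bool" where
  "poly_deg_le n d p \<longleftrightarrow>
     (\<exists>A c. finite A \<and>
        (\<forall>\<alpha>\<in>A. (\<forall>i. n \<le> i \<longrightarrow> \<alpha> i = 0) \<and> (\<Sum>i<n. \<alpha> i) \<le> d) \<and>
        (\<forall>x\<in>cube n. p x = (\<Sum>\<alpha>\<in>A. c \<alpha> * (\<Prod>i<n. (of_bool (x ! i) :: real) ^ (\<alpha> i)))))"

definition Ndeg :: "nat \<Rightarrow> (bool list \<Rightarrow> bool) \<Rightarrow> nat" where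
  "Ndeg n f = (LEAST d. \<exists>p. poly_deg_le n d p \<and>
      (\<forall>x\<in>cube n. (\<not> f x \<longrightarrow> \<bar>p x\<bar> \<le> 1/3) \<and> (f x \<longrightarrow> \<bar>p x\<bar> \<ge> 1)))"

definition flip_block :: "nat set \<Rightarrow> bool list \<Rightarrow> bool list" where
  "flip_block B x = map (\<lambda>i. if i \<in> B then \<not> x ! i else x ! i) [0..<length x]"

definition bs_at :: "nat \<Rightarrow> (bool list \<Rightarrow> bool) \<Rightarrow> bool list \<Rightarrow> nat" where
  "bs_at n f x = Max {k. \<exists>Bs :: nat \<Rightarrow> nat set.
      (\<forall>j<k. Bs j \<noteq> {} \<and> Bs j \<subseteq> {..<n} \<and> f (flip_block (Bs j) x) \<noteq> f x) \<and>
      (\<forall>j<k. \<forall>j'<k. j \<noteq> j' \<longrightarrow> Bs j \<inter> Bs j' = {})}"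

definition bs :: "nat \<Rightarrow> (bool list \<Rightarrow> bool) \<Rightarrow> nat" where
  "bs n f = Max (bs_at n f ` cube n)"

definition monotone_path :: "nat \<Rightarrow> bool list list \<Rightarrow> bool" where
  "monotone_path n ps \<longleftrightarrow> ps \<noteq> [] \<and>
     hd ps = replicate n False \<and> last ps = replicate n True \<and>
     (\<forall>i. Suc i < length ps \<longrightarrow>
        (\<exists>j<n. \<not> (ps ! i) ! j \<and> ps ! Suc i = (ps ! i)[j := True]))"

definition alternation :: "(bool list \<Rightarrow> bool) \<Rightarrow> bool list list \<Rightarrow> nat" where
  "alternation f ps = card {i. Suc i < length ps \<and> f (ps ! i) \<noteq> f (ps ! Suc i)}"

definition alt :: "nat \<Rightarrow> (bool list \<Rightarrow> bool) \<Rightarrow> nat" where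
  "alt n f = Max {alternation f ps | ps. monotone_path n ps}"

end

theory Submission
  imports Defs "HOL-Computational_Algebra.Polynomial" "HOL-Library.Disjoint_Sets"
begin

text \<open>Points are identified with subsets of the coordinate set. If \<open>f\<close> is constant on an interval
  \<open>[M, X]\<close> except at one of its two ends, symmetrizing a polynomial for \<open>f\<close> or its negation over
  the interval gives a univariate polynomial that is large at one point and small at the other
  \<open>|X - M|\<close> ones, so \<open>|X - M| \<le> D := 4 max (N(f)\<^sup>2) (N(\<not>f)\<^sup>2)\<close>. Consequently, \<open>m\<close>
  alternations upward from a point can be realized while adding only \<open>m D\<close> elements.

  Split each sensitive block of \<open>x\<close> into its upward part \<open>U i\<close> and its downward part \<open>W i\<close>, and
  let \<open>k\<close> bound the alternations between the bottom point \<open>x - \<Union>W\<close> and the top point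
  \<open>x \<union> \<Union>U\<close>. One finds \<open>m \<ge> 1\<close> and a new base point at which all but \<open>2 m D\<close> of the blocks
  stay sensitive while only \<open>k - m\<close> alternations remain available; by induction on \<open>k\<close> there
  are at most \<open>2 k D\<close> blocks.\<close>

section \<open>Alternation along chains of sets\<close>

text \<open>The chains may skip levels of the cube, and only changes between consecutive members are
  counted.\<close>

inductive alternates :: "('a set \<Rightarrow> bool) \<Rightarrow> nat \<Rightarrow> 'a set \<Rightarrow> 'a set \<Rightarrow> bool" for F where
  start: "alternates F 0 A A"
| extend: "alternates F m A B \<Longrightarrow> B \<subseteq> C \<Longrightarrow> alternates F (m + of_bool (F B \<noteq> F C)) A C"

lemma alternates_subset: "alternates F m A B \<Longrightarrow> A \<subseteq> B"
  by (induction rule: alternates.induct) auto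

lemma alternates_single: "A \<subseteq> B \<Longrightarrow> alternates F (of_bool (F A \<noteq> F B)) A B"
  using alternates.extend[OF alternates.start, of A B F] by simp

lemma alternates_Suc: "alternates F m A B \<Longrightarrow> B \<subseteq> C \<Longrightarrow> F B \<noteq> F C \<Longrightarrow> alternates F (Suc m) A C"
  using alternates.extend[of F m A B C] by simp

lemma alternates_trans:
  assumes "alternates F m A B" "alternates F k B C"
  shows "alternates F (m + k) A C"
  using assms(2,1)
proof (induction rule: alternates.induct)
  case (start A) then show ?case by simp
next
  case (extend k B C E)
  then show ?case using alternates.extend[of F "m + k" A C E] by (simp add: add.assoc)
qed

text \<open>Prolonging a chain at either end can only add changes, so the count is controlled from
  below and not exactly.\<close>

lemma alternates_widen:
  assumes "alternates F m A B" "A' \<subseteq> A" "B \<subseteq> B'"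
  obtains m' where "m \<le> m'" "alternates F m' A' B'"
  using alternates_trans[OF alternates_trans[OF alternates_single[OF assms(2), of F] assms(1)]
      alternates_single[OF assms(3), of F]] by (meson le_add1 le_add2 order_trans)

text \<open>Complementing twice in \<open>V\<close> gives back a function that agrees with
  \<open>F\<close> only on subsets of \<open>V\<close>; this transfers chains between the
  two.\<close>

lemma alternates_cong:
  assumes "alternates F m A B" "B \<subseteq> V" "\<And>S. S \<subseteq> V \<Longrightarrow> F S = G S"
  shows "alternates G m A B"
  using assms(1,2)
proof (induction rule: alternates.induct)
  case (start A) then show ?case by (simp add: alternates.start)
next
  case (extend m A B C)
  then have "B \<subseteq> V" by auto
  then show ?case using alternates.extend[of G m A B C] extend assms(3) by auto
qed

text \<open>Complementation reverses inclusions and keeps the changes of value. Every downward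
  statement is obtained from its upward twin through this duality.\<close>

lemma alternates_compl:
  assumes "alternates F m A B" "B \<subseteq> V"
  shows "alternates (\<lambda>S. F (V - S)) m (V - B) (V - A)"
  using assms
proof (induction rule: alternates.induct)
  case (start A) then show ?case by (simp add: alternates.start)
next
  case (extend m A B C)
  have BV: "B \<subseteq> V" and AV: "A \<subseteq> V"
    using extend alternates_subset[OF extend(1)] by auto
  have "alternates (\<lambda>S. F (V - S)) (of_bool (F B \<noteq> F C)) (V - C) (V - B)"
    using alternates_single[of "V - C" "V - B" "\<lambda>S. F (V - S)"] extend(2) extend.prems BV
    by (simp add: double_diff Diff_mono eq_commute)
  from alternates_trans[OF this extend.IH[OF BV]] show ?case by (simp add: add.commute)
qed

text \<open>Cut the chain at its last change of value; whatever follows is constant and is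
  discarded.\<close>

lemma alternates_SucE:
  assumes "alternates F (Suc m) A B"
  obtains C E where "alternates F m A C" "C \<subseteq> E" "E \<subseteq> B" "F C \<noteq> F E"
proof -
  have "alternates F k A B \<Longrightarrow> k = Suc m \<Longrightarrow>
      \<exists>C E. alternates F m A C \<and> C \<subseteq> E \<and> E \<subseteq> B \<and> F C \<noteq> F E" for k
  proof (induction rule: alternates.induct)
    case (extend k A B C)
    show ?case
    proof (cases "F B = F C")
      case True
      then obtain P Q where "alternates F m A P" "P \<subseteq> Q" "Q \<subseteq> B" "F P \<noteq> F Q"
        using extend by auto
      then show ?thesis using extend(2) by blast
    next
      case False
      then show ?thesis using extend by auto
    qed
  qed auto
  then show ?thesis using assms that by blast
qed

section \<open>Intervals with one exceptional end, and economical chains\<close>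

text \<open>As \<open>F\<close> is Boolean, the alternatives say that \<open>F\<close> is constant
  on \<open>[M, X]\<close> except at the top or at the bottom. This is the only fact about
  \<open>F\<close> that the combinatorial part takes from polynomials.\<close>

definition point_interval_bound :: "'a set \<Rightarrow> ('a set \<Rightarrow> bool) \<Rightarrow> nat \<Rightarrow> bool" where
  "point_interval_bound V F D \<longleftrightarrow> (\<forall>M X. M \<subseteq> X \<longrightarrow> X \<subseteq> V \<longrightarrow>
     (\<forall>Z. M \<subseteq> Z \<longrightarrow> Z \<subset> X \<longrightarrow> F Z \<noteq> F X) \<or> (\<forall>Z. M \<subset> Z \<longrightarrow> Z \<subseteq> X \<longrightarrow> F Z \<noteq> F M) \<longrightarrow>
     card (X - M) \<le> D)"

lemma point_interval_bound_top:
  assumes "point_interval_bound V F D" "M \<subseteq> X" "X \<subseteq> V"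
    and "\<And>Z. M \<subseteq> Z \<Longrightarrow> Z \<subset> X \<Longrightarrow> F Z \<noteq> F X"
  shows "card (X - M) \<le> D"
  by (rule assms(1)[unfolded point_interval_bound_def, rule_format, OF assms(2,3)])
    (intro disjI1 allI impI assms(4))

text \<open>The two alternatives of the definition trade places under complementation.\<close>

lemma point_interval_bound_compl:
  assumes "point_interval_bound V F D"
  shows "point_interval_bound V (\<lambda>S. F (V - S)) D"
  unfolding point_interval_bound_def
proof (intro allI impI)
  fix M X
  assume MX: "M \<subseteq> X" "X \<subseteq> V"
    and H: "(\<forall>Z. M \<subseteq> Z \<longrightarrow> Z \<subset> X \<longrightarrow> F (V - Z) \<noteq> F (V - X)) \<or>
            (\<forall>Z. M \<subset> Z \<longrightarrow> Z \<subseteq> X \<longrightarrow> F (V - Z) \<noteq> F (V - M))"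
  have *: "V - (V - Z) = Z" if "Z \<subseteq> V" for Z using that by auto
  have 1: "M \<subseteq> V - Z" "V - Z \<subset> X" if "V - X \<subset> Z" "Z \<subseteq> V - M" for Z
    using that MX by auto
  have 2: "M \<subset> V - Z" "V - Z \<subseteq> X" if "V - X \<subseteq> Z" "Z \<subset> V - M" for Z
    using that MX by auto
  have 3: "Z \<subseteq> V" if "Z \<subseteq> V - M" for Z using that by auto
  have "(\<forall>Z. V - X \<subset> Z \<longrightarrow> Z \<subseteq> V - M \<longrightarrow> F Z \<noteq> F (V - X)) \<or>
        (\<forall>Z. V - X \<subseteq> Z \<longrightarrow> Z \<subset> V - M \<longrightarrow> F Z \<noteq> F (V - M))"
    using H
  proof (elim disjE)
    assume a: "\<forall>Z. M \<subseteq> Z \<longrightarrow> Z \<subset> X \<longrightarrow> F (V - Z) \<noteq> F (V - X)"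
    show ?thesis
      by (rule disjI1) (metis a 1 3 *)
  next
    assume a: "\<forall>Z. M \<subset> Z \<longrightarrow> Z \<subseteq> X \<longrightarrow> F (V - Z) \<noteq> F (V - M)"
    show ?thesis
      by (rule disjI2) (metis a 2 3 * psubset_imp_subset)
  qed
  then have "card ((V - M) - (V - X)) \<le> D"
    using assms[unfolded point_interval_bound_def, rule_format, of "V - X" "V - M"] MX by blast
  moreover have "(V - M) - (V - X) = X - M" using MX by auto
  ultimately show "card (X - M) \<le> D" by simp
qed

text \<open>Take an inclusion-minimal end \<open>X\<close> of a chain with \<open>Suc m\<close>
  changes and shrink the part before its last change to a set \<open>M\<close> by induction.
  Minimality forces \<open>F\<close> to be constant on \<open>[M, X]\<close> below \<open>X\<close>,
  so the last change costs at most \<open>D\<close> elements.\<close>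

lemma alternates_shrink:
  assumes fin: "finite V" and D: "point_interval_bound V F D"
    and "alternates F m L Y" "Y \<subseteq> V"
  shows "\<exists>M. L \<subseteq> M \<and> M \<subseteq> Y \<and> alternates F m L M \<and> card (M - L) \<le> m * D"
  using assms(3,4)
proof (induction m arbitrary: Y)
  case 0
  then show ?case using alternates_subset[OF 0(1)] by (intro exI[of _ L]) (auto intro: alternates.start)
next
  case (Suc m)
  let ?S = "{Z. Z \<subseteq> Y \<and> alternates F (Suc m) L Z}"
  have "finite ?S" by (rule finite_subset[of _ "Pow V"]) (use fin Suc.prems(2) in auto)
  moreover have "Y \<in> ?S" using Suc.prems by simp
  ultimately have "\<exists>X\<in>?S. \<forall>Z\<in>?S. Z \<subseteq> X \<longrightarrow> X = Z"
    by (intro finite_has_minimal) auto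
  then obtain X where X: "X \<in> ?S" and min: "\<And>Z. Z \<in> ?S \<Longrightarrow> Z \<subseteq> X \<Longrightarrow> X = Z"
    by (elim bexE) blast
  obtain B C where BC: "alternates F m L B" "B \<subseteq> C" "C \<subseteq> X" "F B \<noteq> F C"
    using X alternates_SucE by blast
  \<comment> \<open>The chain that stops right after the last change already has
    \<open>Suc m\<close> changes, so by minimality that change happens at \<open>X\<close>.\<close>
  have "C = X" using min[of C] BC X alternates_Suc by blast
  then have B: "B \<subseteq> X" "B \<subset> X" "F B \<noteq> F X" using BC by auto
  have XV: "X \<subseteq> V" using X Suc.prems by auto
  obtain M where M: "L \<subseteq> M" "M \<subseteq> B" "alternates F m L M" "card (M - L) \<le> m * D"
    using Suc.IH[OF BC(1)] B XV by blast
  have const: "F Z = F M" if "M \<subseteq> Z" "Z \<subset> X" for Z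
  proof (rule ccontr)
    assume "F Z \<noteq> F M"
    then have "alternates F (Suc m) L Z" using alternates_Suc[OF M(3) that(1)] by auto
    then show False using min[of Z] that X by auto
  qed
  have "card (X - M) \<le> D"
  proof -
    have "F Z \<noteq> F X" if "M \<subseteq> Z" "Z \<subset> X" for Z using const[of B] const[OF that] B M by simp
    then show ?thesis using point_interval_bound_top[OF D _ XV, of M] M(2) B(1) by blast
  qed
  moreover have "card (X - L) = card (X - M) + card (M - L)"
  proof -
    have "finite X" using XV fin finite_subset by blast
    moreover have "X - L = (X - M) \<union> (M - L)" using M B by auto
    moreover have "finite M" using \<open>finite X\<close> M(2) B(1) by (meson finite_subset)
    moreover have "(X - M) \<inter> (M - L) = {}" by auto
    ultimately show ?thesis using card_Un_disjoint[of "X - M" "M - L"] by simp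
  qed
  ultimately have "card (X - L) \<le> Suc m * D" using M(4) by simp
  then show ?case using X alternates_subset[of F "Suc m" L X] by blast
qed

lemma alternates_grow:
  assumes fin: "finite V" and D: "point_interval_bound V F D"
    and a: "alternates F m Y H" and H: "H \<subseteq> V"
  shows "\<exists>N. Y \<subseteq> N \<and> N \<subseteq> H \<and> alternates F m N H \<and> card (H - N) \<le> m * D"
proof -
  have YH: "Y \<subseteq> H" using a alternates_subset by blast
  obtain M where M: "V - H \<subseteq> M" "M \<subseteq> V - Y" "alternates (\<lambda>S. F (V - S)) m (V - H) M"
      "card (M - (V - H)) \<le> m * D"
    using alternates_shrink[OF fin point_interval_bound_compl[OF D] alternates_compl[OF a H]] by blast
  have "alternates (\<lambda>S. F (V - (V - S))) m (V - M) (V - (V - H))"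
    using alternates_compl[OF M(3), of V] M(2) by blast
  moreover have "M - (V - H) = H - (V - M)" "V - (V - H) = H" using H M(1,2) by auto
  ultimately have M': "alternates (\<lambda>S. F (V - (V - S))) m (V - M) H" "card (H - (V - M)) \<le> m * D"
    using M(4) by simp_all
  have "alternates F m (V - M) H"
    by (rule alternates_cong[OF M'(1) H]) (simp add: double_diff)
  moreover have "Y \<subseteq> V - M" "V - M \<subseteq> H" using M(1,2) YH H by auto
  ultimately show ?thesis using M'(2) by blast
qed

text \<open>Pick an element of \<open>T\<close> in every block that meets \<open>T\<close>;
  disjointness makes the choice injective.\<close>

lemma card_blocks_hit:
  assumes "finite T" "disjoint_family_on B I"
  shows "card {i \<in> I. B i \<inter> T \<noteq> {}} \<le> card T"
proof -
  let ?J = "{i \<in> I. B i \<inter> T \<noteq> {}}"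
  define g where "g i = (SOME t. t \<in> B i \<inter> T)" for i
  have g: "g i \<in> B i \<inter> T" if "i \<in> ?J" for i
  proof -
    have "\<exists>t. t \<in> B i \<inter> T" using that by auto
    then show ?thesis unfolding g_def by (rule someI_ex)
  qed
  have "inj_on g ?J"
  proof (rule inj_onI)
    fix i j assume ij: "i \<in> ?J" "j \<in> ?J" "g i = g j"
    then have "g i \<in> B i \<inter> B j" using g[of i] g[of j] by auto
    then show "i = j" using assms(2) ij unfolding disjoint_family_on_def by blast
  qed
  then show ?thesis using g assms(1) by (intro card_inj_on_le[of g]) auto
qed

section \<open>Trading blocks for alternations\<close>

text \<open>The families \<open>U\<close> and \<open>W\<close> are kept apart from the index set so
  that a move changes only the base point \<open>x\<close> and the set \<open>I\<close> of surviving
  blocks. The number \<open>k\<close> is merely an upper bound, a budget that moves spend.\<close>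

definition sensitive_config ::
  "'a set \<Rightarrow> ('a set \<Rightarrow> bool) \<Rightarrow> 'a set \<Rightarrow> ('i \<Rightarrow> 'a set) \<Rightarrow> ('i \<Rightarrow> 'a set) \<Rightarrow> 'i set \<Rightarrow> nat \<Rightarrow> bool" where
  "sensitive_config V F x U W I k \<longleftrightarrow>
     finite I \<and> x \<subseteq> V \<and> disjoint_family_on U I \<and> disjoint_family_on W I \<and>
     (\<forall>i\<in>I. U i \<subseteq> V - x \<and> W i \<subseteq> x \<and> F (x \<union> U i - W i) \<noteq> F x) \<and>
     (\<forall>m. alternates F m (x - \<Union>(W ` I)) (x \<union> \<Union>(U ` I)) \<longrightarrow> m \<le> k)"

lemma sensitive_config_compl:
  assumes "sensitive_config V F x U W I k"
  shows "sensitive_config V (\<lambda>S. F (V - S)) (V - x) W U I k"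
proof -
  have c: "finite I" "x \<subseteq> V" "disjoint_family_on U I" "disjoint_family_on W I"
      "\<And>i. i \<in> I \<Longrightarrow> U i \<subseteq> V - x" "\<And>i. i \<in> I \<Longrightarrow> W i \<subseteq> x"
      "\<And>i. i \<in> I \<Longrightarrow> F (x \<union> U i - W i) \<noteq> F x"
      "\<And>m. alternates F m (x - \<Union>(W ` I)) (x \<union> \<Union>(U ` I)) \<Longrightarrow> m \<le> k"
    using assms unfolding sensitive_config_def by simp_all
  have "V - (V - x \<union> W i - U i) = x \<union> U i - W i" if "i \<in> I" for i
    using c(2) c(5,6)[OF that] by auto
  moreover have "V - (V - x) = x" using c(2) by auto
  moreover have "m \<le> k"
    if m: "alternates (\<lambda>S. F (V - S)) m (V - x - \<Union>(U ` I)) (V - x \<union> \<Union>(W ` I))" for m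
  proof -
    have sub: "V - x \<union> \<Union>(W ` I) \<subseteq> V" using c(2,6) by blast
    have "alternates (\<lambda>S. F (V - (V - S))) m (V - (V - x \<union> \<Union>(W ` I))) (V - (V - x - \<Union>(U ` I)))"
      by (rule alternates_compl[OF m sub])
    moreover have "V - (V - x \<union> \<Union>(W ` I)) = x - \<Union>(W ` I)" using c(2) by auto
    moreover have "V - (V - x - \<Union>(U ` I)) = x \<union> \<Union>(U ` I)" using c(2,5) by blast
    ultimately have a: "alternates (\<lambda>S. F (V - (V - S))) m (x - \<Union>(W ` I)) (x \<union> \<Union>(U ` I))" by simp
    have "x \<union> \<Union>(U ` I) \<subseteq> V" using c(2,5) by blast
    from alternates_cong[OF a this] have "alternates F m (x - \<Union>(W ` I)) (x \<union> \<Union>(U ` I))"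
      by (simp add: double_diff)
    then show ?thesis by (rule c(8))
  qed
  moreover have "W i \<subseteq> V - (V - x)" if "i \<in> I" for i using c(2) c(6)[OF that] by auto
  ultimately show ?thesis
    unfolding sensitive_config_def using c(1,3-5,7) by simp
qed

text \<open>One step of the induction: \<open>m\<close> alternations are spent and at most
  \<open>2 * m * D\<close> blocks are lost. The bound \<open>m \<le> k\<close> keeps the truncated
  difference \<open>k - m\<close> faithful.\<close>

definition reducible ::
  "'a set \<Rightarrow> ('a set \<Rightarrow> bool) \<Rightarrow> nat \<Rightarrow> ('i \<Rightarrow> 'a set) \<Rightarrow> ('i \<Rightarrow> 'a set) \<Rightarrow> 'i set \<Rightarrow> nat \<Rightarrow> bool" where
  "reducible V F D U W I k \<longleftrightarrow> (\<exists>m y J. 1 \<le> m \<and> m \<le> k \<and> card I \<le> card J + 2 * m * D \<and>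
     sensitive_config V F y U W J (k - m))"

lemma sensitive_config_cong:
  assumes "sensitive_config V F x U W I k" "\<And>S. S \<subseteq> V \<Longrightarrow> F S = G S"
  shows "sensitive_config V G x U W I k"
proof -
  have c: "finite I" "x \<subseteq> V" "disjoint_family_on U I" "disjoint_family_on W I"
      "\<And>i. i \<in> I \<Longrightarrow> U i \<subseteq> V - x" "\<And>i. i \<in> I \<Longrightarrow> W i \<subseteq> x"
      "\<And>i. i \<in> I \<Longrightarrow> F (x \<union> U i - W i) \<noteq> F x"
      "\<And>m. alternates F m (x - \<Union>(W ` I)) (x \<union> \<Union>(U ` I)) \<Longrightarrow> m \<le> k"
    using assms(1) unfolding sensitive_config_def by simp_all
  have "x \<union> U i - W i \<subseteq> V" if "i \<in> I" for i using c(2) c(5)[OF that] by auto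
  moreover have hi: "x \<union> \<Union>(U ` I) \<subseteq> V" using c(2,5) by blast
  moreover have "m \<le> k" if "alternates G m (x - \<Union>(W ` I)) (x \<union> \<Union>(U ` I))" for m
    by (rule c(8), rule alternates_cong[OF that hi]) (simp add: assms(2))
  ultimately show ?thesis
    unfolding sensitive_config_def using c(1-7) assms(2) by simp
qed

lemma reducible_compl:
  assumes "reducible V (\<lambda>S. F (V - S)) D W U I k"
  shows "reducible V F D U W I k"
proof -
  obtain m y J where *: "1 \<le> m" "m \<le> k" "card I \<le> card J + 2 * m * D"
      "sensitive_config V (\<lambda>S. F (V - S)) y W U J (k - m)"
    using assms unfolding reducible_def by blast
  have "sensitive_config V F (V - y) U W J (k - m)"
    by (rule sensitive_config_cong[OF sensitive_config_compl[OF *(4)]]) (simp add: double_diff)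
  then show ?thesis unfolding reducible_def using *(1-3) by blast
qed

text \<open>The budget drops by \<open>m\<close> because chains compose: \<open>m\<close> changes
  from the old bottom to \<open>M\<close>, then any chain of the new configuration, whose bottom
  contains \<open>M\<close> and whose top lies below the old top.\<close>

lemma sensitive_config_restrict:
  assumes c: "sensitive_config V F x U W I k"
    and J: "J \<subseteq> I" "\<And>i. i \<in> J \<Longrightarrow> W i \<inter> M = {}"
    and y: "y \<subseteq> V" "M \<subseteq> y" "y \<subseteq> x \<union> \<Union>(U ` I)"
    and yJ: "\<And>i. i \<in> J \<Longrightarrow> U i \<inter> y = {} \<and> W i \<subseteq> y \<and> F (y \<union> U i - W i) \<noteq> F y"
    and M: "alternates F m (x - \<Union>(W ` I)) M"
  shows "m \<le> k" "sensitive_config V F y U W J (k - m)"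
proof -
  have c': "finite I" "x \<subseteq> V" "disjoint_family_on U I" "disjoint_family_on W I"
      "\<And>i. i \<in> I \<Longrightarrow> U i \<subseteq> V - x" "\<And>i. i \<in> I \<Longrightarrow> W i \<subseteq> x"
      "\<And>m. alternates F m (x - \<Union>(W ` I)) (x \<union> \<Union>(U ` I)) \<Longrightarrow> m \<le> k"
    using c unfolding sensitive_config_def by simp_all
  have add: "m + m' \<le> k" if m': "alternates F m' (y - \<Union>(W ` J)) (y \<union> \<Union>(U ` J))" for m'
  proof -
    have "M \<subseteq> y - \<Union>(W ` J)" using y(2) J(2) by blast
    moreover have "y \<union> \<Union>(U ` J) \<subseteq> x \<union> \<Union>(U ` I)" using y(3) J(1) by blast
    ultimately obtain m'' where m'': "m' \<le> m''" "alternates F m'' M (x \<union> \<Union>(U ` I))"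
      using alternates_widen[of F m' "y - \<Union>(W ` J)" "y \<union> \<Union>(U ` J)"] m' by metis
    from c'(7)[OF alternates_trans[OF M m''(2)]] m''(1) show ?thesis by simp
  qed
  have "y - \<Union>(W ` J) \<subseteq> y \<union> \<Union>(U ` J)" by auto
  \<comment> \<open>Any chain of the new configuration will do here; the single step from bottom to
    top always exists.\<close>
  from add[OF alternates_single[OF this]] show "m \<le> k" by simp
  have "disjoint_family_on U J" "disjoint_family_on W J"
    using c'(3,4) J(1) by (meson disjoint_family_on_mono)+
  moreover have "finite J" using c'(1) J(1) finite_subset by blast
  moreover have "U i \<subseteq> V - y" if "i \<in> J" for i using c'(5)[of i] yJ[OF that] J(1) that by blast
  moreover have "m' \<le> k - m" if "alternates F m' (y - \<Union>(W ` J)) (y \<union> \<Union>(U ` J))" for m'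
    using add[OF that] by simp
  ultimately show "sensitive_config V F y U W J (k - m)"
    unfolding sensitive_config_def using y(1) yJ by simp
qed

text \<open>One alternation already occurs below \<open>x\<close> and can be realized with at most
  \<open>D\<close> added elements. The base point stays, and only blocks whose downward part meets
  these elements are dropped, which is the case \<open>m = 1\<close>.\<close>

lemma reducible_if_nonconstant_below:
  assumes fin: "finite V" and D: "point_interval_bound V F D"
    and c: "sensitive_config V F x U W I k"
    and Z: "x - \<Union>(W ` I) \<subseteq> Z" "Z \<subseteq> x" "F Z \<noteq> F x"
  shows "reducible V F D U W I k"
proof -
  let ?lo = "x - \<Union>(W ` I)"
  have c': "finite I" "x \<subseteq> V" "disjoint_family_on W I"
      "\<And>i. i \<in> I \<Longrightarrow> U i \<subseteq> V - x" "\<And>i. i \<in> I \<Longrightarrow> W i \<subseteq> x"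
      "\<And>i. i \<in> I \<Longrightarrow> F (x \<union> U i - W i) \<noteq> F x"
    using c unfolding sensitive_config_def by simp_all
  \<comment> \<open>As \<open>F\<close> differs at \<open>Z\<close> and \<open>x\<close>, one of the
    two differs from the bottom.\<close>
  have "\<exists>Y\<subseteq>x. ?lo \<subseteq> Y \<and> F ?lo \<noteq> F Y" using Z by blast
  then obtain Y where Y: "Y \<subseteq> x" "?lo \<subseteq> Y" "F ?lo \<noteq> F Y" by blast
  have "alternates F 1 ?lo Y" using alternates_single[OF Y(2), of F] Y(3) by simp
  then obtain M where M: "?lo \<subseteq> M" "M \<subseteq> Y" "alternates F 1 ?lo M" "card (M - ?lo) \<le> 1 * D"
    using alternates_shrink[OF fin D] Y(1) c'(2) by (meson order_trans)
  let ?K = "{i \<in> I. W i \<inter> (M - ?lo) \<noteq> {}}"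
  have "finite (M - ?lo)" using M(2) Y(1) c'(2) fin by (meson Diff_subset finite_subset order_trans)
  then have K: "card ?K \<le> D" using card_blocks_hit[OF _ c'(3)] M(4) by fastforce
  have "W i \<inter> M = {}" if "i \<in> I - ?K" for i using that by blast
  moreover have "U i \<inter> x = {} \<and> W i \<subseteq> x \<and> F (x \<union> U i - W i) \<noteq> F x" if "i \<in> I - ?K" for i
    using c'(4-6)[of i] that by blast
  ultimately have "1 \<le> k \<and> sensitive_config V F x U W (I - ?K) (k - 1)"
    using sensitive_config_restrict[OF c, of "I - ?K" M x 1] M Y(1) c'(2) by blast
  moreover have "card I \<le> card (I - ?K) + card ?K"
    using card_Diff_subset[of ?K I] c'(1) card_mono[of I ?K] by (simp add: finite_subset)
  ultimately show ?thesis unfolding reducible_def using K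
    by (intro exI[of _ 1] exI[of _ x] exI[of _ "I - ?K"]) auto
qed

text \<open>Adding \<open>U e\<close> to \<open>x\<close> returns from the flipped point \<open>x \<union> U e - W e\<close> to the value at \<open>x\<close>,
  which puts one more than \<open>a e\<close> alternations below the new base point. Block \<open>i\<close> survives the move
  if \<open>U e\<close> avoids the at most \<open>r i * D\<close> elements above \<open>N i\<close>; as \<open>sum r I \<le> sum a I\<close>, averaging
  gives an \<open>e\<close> that destroys at most \<open>a e * D\<close> blocks in this way.\<close>

lemma reducible_by_upward_move:
  assumes fin: "finite V" and D: "point_interval_bound V F D"
    and c: "sensitive_config V F x U W I k" and I: "I \<noteq> {}"
    and below: "\<And>Z. x - \<Union>(W ` I) \<subseteq> Z \<Longrightarrow> Z \<subseteq> x \<Longrightarrow> F Z = F x"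
    and above: "\<And>Z. x \<subseteq> Z \<Longrightarrow> Z \<subseteq> x \<union> \<Union>(U ` I) \<Longrightarrow> F Z = F x"
    and a: "\<And>i. i \<in> I \<Longrightarrow> alternates F (a i) (x - \<Union>(W ` I)) (x \<union> U i - W i)"
    and r: "\<And>i. i \<in> I \<Longrightarrow> alternates F (r i) (x \<union> U i - W i) (x \<union> \<Union>(U ` I))"
    and r_max: "\<And>i m. i \<in> I \<Longrightarrow> alternates F m (x \<union> U i - W i) (x \<union> \<Union>(U ` I)) \<Longrightarrow> m \<le> r i"
    and le: "sum r I \<le> sum a I"
  shows "reducible V F D U W I k"
proof -
  let ?lo = "x - \<Union>(W ` I)" and ?hi = "x \<union> \<Union>(U ` I)"
  have c': "finite I" "x \<subseteq> V" "disjoint_family_on U I" "disjoint_family_on W I"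
      "\<And>i. i \<in> I \<Longrightarrow> U i \<subseteq> V - x" "\<And>i. i \<in> I \<Longrightarrow> W i \<subseteq> x"
      "\<And>i. i \<in> I \<Longrightarrow> F (x \<union> U i - W i) \<noteq> F x"
    using c unfolding sensitive_config_def by simp_all
  have hiV: "?hi \<subseteq> V" using c'(2,5) by blast
  then have finhi: "finite ?hi" using fin finite_subset by blast
  have "\<exists>N. x \<union> U i - W i \<subseteq> N \<and> N \<subseteq> ?hi \<and> alternates F (r i) N ?hi \<and> card (?hi - N) \<le> r i * D"
    if "i \<in> I" for i by (rule alternates_grow[OF fin D r[OF that] hiV])
  then obtain N where N: "\<And>i. i \<in> I \<Longrightarrow> x \<union> U i - W i \<subseteq> N i" "\<And>i. i \<in> I \<Longrightarrow> N i \<subseteq> ?hi"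
      "\<And>i. i \<in> I \<Longrightarrow> alternates F (r i) (N i) ?hi" "\<And>i. i \<in> I \<Longrightarrow> card (?hi - N i) \<le> r i * D"
    by metis
  \<comment> \<open>a change of value between the flipped point and \<open>N i\<close> would lengthen a longest chain\<close>
  have N_const: "F Y \<noteq> F x" if "i \<in> I" "x \<union> U i - W i \<subseteq> Y" "Y \<subseteq> N i" for i Y
  proof
    assume "F Y = F x"
    then have "alternates F 1 (x \<union> U i - W i) Y"
      using alternates_single[OF that(2), of F] c'(7)[OF that(1)] by simp
    from alternates_trans[OF alternates_trans[OF this alternates_single[OF that(3)]] N(3)[OF that(1)]]
    have "1 + of_bool (F Y \<noteq> F (N i)) + r i \<le> r i" by (rule r_max[OF that(1)])
    then show False by simp
  qed
  \<comment> \<open>\<open>kill i\<close> collects the moves \<open>e\<close> that may push the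
    flipped point of block \<open>i\<close> out of the region below \<open>N i\<close>, where the
    value is known.\<close>
  define kill where "kill i = {e \<in> I. U e \<inter> (?hi - N i) \<noteq> {}}" for i
  have kill: "card (kill i) \<le> r i * D" if "i \<in> I" for i
    unfolding kill_def using card_blocks_hit[OF _ c'(3), of "?hi - N i"] finhi N(4)[OF that]
    by (meson finite_Diff order_trans)
  \<comment> \<open>Otherwise counting the pairs \<open>(e, i)\<close> with
    \<open>e \<in> kill i\<close> in both orders gives
    \<open>sum a I * D < sum r I * D\<close>.\<close>
  have "\<exists>e\<in>I. card {i \<in> I. e \<in> kill i} \<le> a e * D"
  proof (rule ccontr)
    assume "\<not> ?thesis"
    then have "(\<Sum>e\<in>I. a e * D) < (\<Sum>e\<in>I. card {i \<in> I. e \<in> kill i})"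
      using c'(1) I by (intro sum_strict_mono) auto
    also have "\<dots> = (\<Sum>i\<in>I. card {e \<in> I. e \<in> kill i})"
      by (rule sum_multicount_gen[symmetric]) (use c'(1) in auto)
    also have "\<dots> = (\<Sum>i\<in>I. card (kill i))" by (intro sum.cong arg_cong[where f = card]) (auto simp: kill_def)
    also have "\<dots> \<le> (\<Sum>i\<in>I. r i * D)" by (rule sum_mono) (rule kill)
    also have "\<dots> = sum r I * D" by (simp add: sum_distrib_right)
    also have "\<dots> \<le> sum a I * D" using le by simp
    finally show False by (simp add: sum_distrib_right)
  qed
  then obtain e where e: "e \<in> I" "card {i \<in> I. e \<in> kill i} \<le> a e * D" by blast
  define y where "y = x \<union> U e"
  have y: "x \<subseteq> y" "y \<subseteq> ?hi" "F y = F x" using above[of y] e(1) unfolding y_def by auto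
  have yV: "y \<subseteq> V" using y(2) hiV by blast
  have "alternates F (Suc (a e)) ?lo y"
    by (rule alternates_Suc[OF a[OF e(1)]]) (use y(3) c'(7)[OF e(1)] in \<open>auto simp: y_def\<close>)
  then obtain M where M: "?lo \<subseteq> M" "M \<subseteq> y" "alternates F (Suc (a e)) ?lo M" "card (M - ?lo) \<le> Suc (a e) * D"
    using alternates_shrink[OF fin D _ yV] by blast
  have finM: "finite (M - ?lo)" using M(2) y(2) finhi by (meson finite_Diff finite_subset)
  \<comment> \<open>Block \<open>e\<close> is itself lost after the move, and this cost of one must
    be charged to \<open>D\<close>. If \<open>D\<close> were \<open>0\<close>, a chain from the
    bottom to itself would contain a change.\<close>
  have D1: "1 \<le> D"
  proof (rule ccontr)
    assume "\<not> 1 \<le> D"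
    then have "D = 0" by simp
    then have "card (M - ?lo) = 0" using M(4) by simp
    then have "M = ?lo" using M(1) finM by (metis card_0_eq Diff_eq_empty_iff subset_antisym)
    then have "alternates F (Suc (a e)) ?lo ?lo" using M(3) by simp
    then obtain C E where CE: "alternates F (a e) ?lo C" "C \<subseteq> E" "E \<subseteq> ?lo" "F C \<noteq> F E"
      by (rule alternates_SucE)
    have "?lo \<subseteq> C" by (rule alternates_subset[OF CE(1)])
    then have "C = E" using CE(2,3) by (meson order_trans subset_antisym)
    then show False using CE(4) by simp
  qed
  let ?K = "{i \<in> I. W i \<inter> (M - ?lo) \<noteq> {}}" and ?L = "{i \<in> I. e \<in> kill i}"
  \<comment> \<open>The losses are the blocks whose downward part meets \<open>M\<close>, those
    destroyed by adding \<open>U e\<close>, and \<open>e\<close>, whose upward part now lies in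
    \<open>y\<close>.\<close>
  let ?J = "I - ?K - ?L - {e}"
  have K: "card ?K \<le> Suc (a e) * D" using card_blocks_hit[OF finM c'(4)] M(4) by (rule order_trans)
  have "W i \<inter> M = {}" if "i \<in> ?J" for i using that by blast
  moreover have "U i \<inter> y = {} \<and> W i \<subseteq> y \<and> F (y \<union> U i - W i) \<noteq> F y" if i: "i \<in> ?J" for i
  proof -
    have iI: "i \<in> I" "i \<noteq> e" "e \<notin> kill i" using i by auto
    have "U i \<inter> U e = {}" using c'(3) iI e(1) unfolding disjoint_family_on_def by blast
    then have "U i \<inter> y = {}" using c'(5)[OF iI(1)] unfolding y_def by blast
    moreover have "W i \<subseteq> y" using c'(6)[OF iI(1)] y(1) by blast
    moreover have "F (y \<union> U i - W i) \<noteq> F x"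
    proof (rule N_const[OF iI(1)])
      show "x \<union> U i - W i \<subseteq> y \<union> U i - W i" using y(1) by blast
      have "U e \<inter> (?hi - N i) = {}" using iI(3) e(1) unfolding kill_def by simp
      moreover have "U e \<subseteq> ?hi" using e(1) by blast
      ultimately have "U e \<subseteq> N i" by blast
      then show "y \<union> U i - W i \<subseteq> N i" using N(1)[OF iI(1)] unfolding y_def by blast
    qed
    ultimately show ?thesis using y(3) by simp
  qed
  ultimately have red: "Suc (a e) \<le> k" "sensitive_config V F y U W ?J (k - Suc (a e))"
    using sensitive_config_restrict[OF c _ _ yV M(2) y(2) _ M(3), of ?J] by blast+
  have "card I \<le> card (?J \<union> (?K \<union> (?L \<union> {e})))" by (rule card_mono) (use c'(1) in auto)
  also have "\<dots> \<le> card ?J + (card ?K + (card ?L + card {e}))"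
    by (meson card_Un_le add_left_mono order_trans)
  \<comment> \<open>The first loss is paid by shrinking to \<open>M\<close>, the second by
    averaging, the third by \<open>1 \<le> D\<close>; their sum is the source of the factor
    \<open>2\<close>.\<close>
  also have "\<dots> \<le> card ?J + (Suc (a e) * D + (a e * D + D))"
    using K e(2) D1 by (intro add_mono) auto
  also have "\<dots> = card ?J + 2 * Suc (a e) * D" by (simp add: algebra_simps)
  finally show ?thesis unfolding reducible_def using red
    by (intro exI[of _ "Suc (a e)"] exI[of _ y] exI[of _ ?J]) auto
qed

text \<open>If \<open>F\<close> changes below or above \<open>x\<close>, one alternation is
  available at once. Otherwise compare the total lengths of longest chains below and above the
  flipped points: the heavier side decides between an upward move and its complement, a downward
  move.\<close>

lemma sensitive_config_reducible:
  assumes fin: "finite V" and D: "point_interval_bound V F D"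
    and c: "sensitive_config V F x U W I k" and I: "I \<noteq> {}"
  shows "reducible V F D U W I k"
proof -
  let ?lo = "x - \<Union>(W ` I)" and ?hi = "x \<union> \<Union>(U ` I)"
  let ?p = "\<lambda>i. x \<union> U i - W i"
  let ?G = "\<lambda>S. F (V - S)"
  note D' = point_interval_bound_compl[OF D] and cc = sensitive_config_compl[OF c]
  have c': "finite I" "x \<subseteq> V"
      "\<And>i. i \<in> I \<Longrightarrow> U i \<subseteq> V - x" "\<And>i. i \<in> I \<Longrightarrow> W i \<subseteq> x"
      "\<And>m. alternates F m ?lo ?hi \<Longrightarrow> m \<le> k"
    using c unfolding sensitive_config_def by simp_all
  have hiV: "?hi \<subseteq> V" using c'(2,3) by blast
  have compl: "V - x - \<Union>(U ` I) = V - ?hi" "V - x \<union> \<Union>(W ` I) = V - ?lo"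
    using c'(2-4) by blast+
  have compl_p: "V - x \<union> W i - U i = V - ?p i" if "i \<in> I" for i
    using c'(2) c'(3,4)[OF that] by blast
  consider (below) Z where "?lo \<subseteq> Z" "Z \<subseteq> x" "F Z \<noteq> F x"
    | (above) Z where "x \<subseteq> Z" "Z \<subseteq> ?hi" "F Z \<noteq> F x"
    | (const) "\<And>Z. ?lo \<subseteq> Z \<Longrightarrow> Z \<subseteq> x \<Longrightarrow> F Z = F x" "\<And>Z. x \<subseteq> Z \<Longrightarrow> Z \<subseteq> ?hi \<Longrightarrow> F Z = F x"
    by metis
  then show ?thesis
  proof cases
    case below
    then show ?thesis by (rule reducible_if_nonconstant_below[OF fin D c])
  next
    case above
    then have "V - (V - Z) = Z" "V - (V - x) = x" using hiV c'(2) by (meson double_diff order_trans subset_refl)+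
    then have "reducible V ?G D W U I k"
      using above by (intro reducible_if_nonconstant_below[OF fin D' cc, of "V - Z"]) auto
    then show ?thesis by (rule reducible_compl)
  next
    case const
    have p: "?lo \<subseteq> ?p i" "?p i \<subseteq> ?hi" if "i \<in> I" for i using that by auto
    define a where "a i = (GREATEST m. alternates F m ?lo (?p i))" for i
    define r where "r i = (GREATEST m. alternates F m (?p i) ?hi)" for i
    \<comment> \<open>Continuing such a chain to the top shows that \<open>k\<close> bounds its
      length, so the greatest value exists.\<close>
    have a_bd: "m \<le> k" if "i \<in> I" "alternates F m ?lo (?p i)" for i m
      using c'(5)[OF alternates_trans[OF that(2) alternates_single[OF p(2)[OF that(1)]]]] by simp
    have r_bd: "m \<le> k" if "i \<in> I" "alternates F m (?p i) ?hi" for i m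
      using c'(5)[OF alternates_trans[OF alternates_single[OF p(1)[OF that(1)]] that(2)]] by simp
    have a: "alternates F (a i) ?lo (?p i)" if "i \<in> I" for i unfolding a_def
      by (rule GreatestI_nat[of "\<lambda>m. alternates F m ?lo (?p i)", OF alternates_single[OF p(1)[OF that]]]) (rule a_bd[OF that])
    have r: "alternates F (r i) (?p i) ?hi" if "i \<in> I" for i unfolding r_def
      by (rule GreatestI_nat[of "\<lambda>m. alternates F m (?p i) ?hi", OF alternates_single[OF p(2)[OF that]]]) (rule r_bd[OF that])
    have a_max: "m \<le> a i" if "i \<in> I" "alternates F m ?lo (?p i)" for i m unfolding a_def
      by (rule Greatest_le_nat[of "\<lambda>m. alternates F m ?lo (?p i)", OF that(2)]) (rule a_bd[OF that(1)])
    have r_max: "m \<le> r i" if "i \<in> I" "alternates F m (?p i) ?hi" for i m unfolding r_def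
      by (rule Greatest_le_nat[of "\<lambda>m. alternates F m (?p i) ?hi", OF that(2)]) (rule r_bd[OF that(1)])
    show ?thesis
    proof (cases "sum r I \<le> sum a I")
      case True
      show ?thesis by (rule reducible_by_upward_move[OF fin D c I const a r r_max True])
    next
      case False
      have "reducible V ?G D W U I k"
      proof (rule reducible_by_upward_move[OF fin D' cc I, where a = r and r = a])
        fix Z assume "V - x - \<Union>(U ` I) \<subseteq> Z" "Z \<subseteq> V - x"
        then show "F (V - Z) = F (V - (V - x))"
          using const(2)[of "V - Z"] c'(2) hiV by (auto simp: double_diff)
      next
        fix Z assume "V - x \<subseteq> Z" "Z \<subseteq> V - x \<union> \<Union>(W ` I)"
        then show "F (V - Z) = F (V - (V - x))"
          using const(1)[of "V - Z"] c'(2) by (auto simp: double_diff)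
      next
        fix i assume i: "i \<in> I"
        show "alternates ?G (r i) (V - x - \<Union>(U ` I)) (V - x \<union> W i - U i)"
          unfolding compl(1) compl_p[OF i] by (rule alternates_compl[OF r[OF i] hiV])
        have pV: "?p i \<subseteq> V" using p(2)[OF i] hiV by blast
        have lo: "V - (V - ?lo) = ?lo" using c'(2) by blast
        show "alternates ?G (a i) (V - x \<union> W i - U i) (V - x \<union> \<Union>(W ` I))"
          unfolding compl(2) compl_p[OF i] by (rule alternates_compl[OF a[OF i] pV])
        fix m assume "alternates ?G m (V - x \<union> W i - U i) (V - x \<union> \<Union>(W ` I))"
        then have "alternates ?G m (V - ?p i) (V - ?lo)" unfolding compl(2) compl_p[OF i] .
        from alternates_compl[OF this, of V]
        have "alternates (\<lambda>S. F (V - (V - S))) m ?lo (?p i)"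
          using pV lo by (simp add: double_diff)
        from alternates_cong[OF this pV] have "alternates F m ?lo (?p i)" by (simp add: double_diff)
        then show "m \<le> a i" by (rule a_max[OF i])
      next
        show "sum a I \<le> sum r I" using False by simp
      qed
      then show ?thesis by (rule reducible_compl)
    qed
  qed
qed

text \<open>The price per alternation is \<open>2 * D\<close> blocks. With \<open>k = 0\<close> no
  reduction is possible, so no block is left.\<close>

lemma card_sensitive_config_le:
  assumes "finite V" "point_interval_bound V F D" "sensitive_config V F x U W I k"
  shows "card I \<le> 2 * k * D"
  using assms(3)
proof (induction k arbitrary: x I rule: less_induct)
  case (less k)
  show ?case
  proof (cases "I = {}")
    case False
    then obtain m y J where *: "1 \<le> m" "m \<le> k" "card I \<le> card J + 2 * m * D"
        "sensitive_config V F y U W J (k - m)"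
      using sensitive_config_reducible[OF assms(1,2) less.prems] unfolding reducible_def by blast
    then have "card J \<le> 2 * (k - m) * D" by (intro less.IH) auto
    then have "card I \<le> 2 * ((k - m) + m) * D" using *(3) by (simp add: algebra_simps)
    then show ?thesis using *(2) by simp
  qed simp
qed

section \<open>Polynomials with one isolated large value\<close>

text \<open>Pascal's rule: a finite difference of order \<open>Suc n\<close> is one of order
  \<open>n\<close> applied to a first difference.\<close>

lemma alternating_binomial_sum_Suc:
  fixes g :: "nat \<Rightarrow> real"
  shows "(\<Sum>k\<le>Suc n. (-1) ^ k * real (Suc n choose k) * g k) =
    (\<Sum>k\<le>n. (-1) ^ k * real (n choose k) * (g k - g (Suc k)))"
proof -
  have "(\<Sum>k\<le>n. (-1) ^ k * real (n choose k) * g k) = (\<Sum>k\<le>Suc n. (-1) ^ k * real (n choose k) * g k)"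
    by (simp add: binomial_eq_0)
  also have "\<dots> = g 0 - (\<Sum>k\<le>n. (-1) ^ k * real (n choose Suc k) * g (Suc k))"
    by (subst sum.atMost_Suc_shift) (simp add: sum_negf)
  finally show ?thesis
    by (subst sum.atMost_Suc_shift)
      (simp add: algebra_simps sum.distrib sum_negf sum_subtractf)
qed

lemma alternating_binomial_sum_poly_eq_0:
  fixes p :: "real poly"
  assumes "degree p < n"
  shows "(\<Sum>k\<le>n. (-1) ^ k * real (n choose k) * poly p (real k)) = 0"
  using assms
proof (induction n arbitrary: p)
  case (Suc n)
  define p' where "p' = p - p \<circ>\<^sub>p [:1, 1:]"
  have "(\<Sum>k\<le>Suc n. (-1) ^ k * real (Suc n choose k) * poly p (real k)) =
      (\<Sum>k\<le>n. (-1) ^ k * real (n choose k) * poly p' (real k))"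
    unfolding alternating_binomial_sum_Suc p'_def by (simp add: poly_pcompose add.commute)
  also have "\<dots> = 0"
  proof (cases "degree p = 0")
    case True
    then obtain a where "p = [:a:]" by (rule degree_eq_zeroE)
    then show ?thesis by (simp add: p'_def)
  next
    case False
    have "degree p' \<le> degree p"
      unfolding p'_def using degree_diff_le_max[of p "p \<circ>\<^sub>p [:1, 1:]"] by (simp add: degree_pcompose)
    \<comment> \<open>The shift by \<open>1\<close> preserves the leading coefficient, so a first
      difference lowers the degree.\<close>
    moreover have "coeff p' (degree p) = 0"
      unfolding p'_def using lead_coeff_comp[of "[:1, 1:]" p] by (simp add: degree_pcompose)
    ultimately have "p' = 0 \<or> degree p' < degree p" by (rule eq_zero_or_degree_less)
    then show ?thesis using Suc by auto
  qed
  finally show ?case .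
qed simp

lemma sum_inverse_four_square_minus_one:
  fixes d :: nat
  shows "(\<Sum>k\<le>2 * d. 1 / (4 * (real k - real d)\<^sup>2 - 1)) = - 1 / (2 * real d + 1)"
proof -
  \<comment> \<open>Partial fractions of \<open>1 / ((z - 1) * (z + 1))\<close> with
    \<open>z = 2 * (k - d)\<close>; the even integer \<open>z\<close> is never a pole.\<close>
  define f :: "nat \<Rightarrow> real" where "f k = 1 / (2 * (2 * (real k - real d) - 1))" for k
  have "1 / (4 * (real k - real d)\<^sup>2 - 1) = f k - f (Suc k)" for k
  proof -
    define z where "z = 2 * (int k - int d)"
    have "z - 1 \<noteq> 0" "z + 1 \<noteq> 0" unfolding z_def by presburger+
    then have nz: "real_of_int z - 1 \<noteq> 0" "real_of_int z + 1 \<noteq> 0" by linarith+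
    have z: "2 * (real k - real d) = real_of_int z" unfolding z_def by simp
    have *: "4 * (real k - real d)\<^sup>2 - 1 = (real_of_int z - 1) * (real_of_int z + 1)"
      unfolding z[symmetric] by (simp add: power2_eq_square algebra_simps)
    have f: "f k = 1 / (2 * (real_of_int z - 1))" "f (Suc k) = 1 / (2 * (real_of_int z + 1))"
      unfolding f_def z[symmetric] by (simp_all add: algebra_simps)
    show ?thesis unfolding * f using nz by (simp add: divide_simps) (simp add: algebra_simps)
  qed
  then have "(\<Sum>k\<le>2 * d. 1 / (4 * (real k - real d)\<^sup>2 - 1)) = f 0 - f (Suc (2 * d))"
    by (simp only: sum_telescope)
  also have "\<dots> = - 1 / (2 * real d + 1)"
  proof -
    define u where "u = 2 * real d + 1"
    have u: "u \<noteq> 0" unfolding u_def by linarith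
    have "f 0 = 1 / (2 * (- u))" "f (Suc (2 * d)) = 1 / (2 * u)"
      unfolding f_def u_def by (simp_all add: algebra_simps)
    then show ?thesis unfolding u_def[symmetric] using u by (simp add: field_simps)
  qed
  finally show ?thesis .
qed

text \<open>A Markov-type bound without Markov's inequality: the divided difference of \<open>q\<close> at \<open>1\<close>, read at
  the points \<open>4 i\<^sup>2\<close> with \<open>\<bar>i\<bar> \<le> d\<close>, has degree below \<open>2 d\<close> in \<open>i\<close>, so its \<open>2 d\<close>-th finite
  difference vanishes; but the central term outweighs all others.\<close>

lemma poly_isolated_large_value:
  fixes q :: "real poly"
  assumes deg: "degree q \<le> d" and large: "1 \<le> \<bar>poly q 0\<bar>"
    and small: "\<And>j. 1 \<le> j \<Longrightarrow> j \<le> s \<Longrightarrow> \<bar>poly q (real j)\<bar> \<le> 1 / 3"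
  shows "s \<le> 4 * d\<^sup>2"
proof (rule ccontr)
  assume "\<not> s \<le> 4 * d\<^sup>2"
  then have s: "4 * d\<^sup>2 < s" by simp
  have q1: "\<bar>poly q 1\<bar> \<le> 1 / 3" using small[of 1] s by simp
  have d: "0 < d"
  proof (rule ccontr)
    assume "\<not> 0 < d"
    then have "degree q = 0" using deg by simp
    then obtain a where "q = [:a:]" by (rule degree_eq_zeroE)
    then show False using large q1 by simp
  qed
  have "poly (q - [:poly q 1:]) 1 = 0" by simp
  then obtain R where R: "q - [:poly q 1:] = [:-1, 1:] * R" by (metis poly_eq_0_iff_dvd dvdE)
  have R_eval: "(t - 1) * poly R t = poly q t - poly q 1" for t
    using arg_cong[OF R, of "\<lambda>p. poly p t"] by (simp add: algebra_simps)
  have degR: "degree R \<le> d - 1"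
  proof (cases "R = 0")
    case False
    have "degree ([:-1, 1:] * R) = 1 + degree R"
      using False by (subst degree_mult_eq) auto
    moreover have "degree (q - [:poly q 1:]) \<le> d"
      using degree_diff_le_max[of q "[:poly q 1:]"] deg by simp
    ultimately show ?thesis using R by simp
  qed simp
  \<comment> \<open>The substitution doubles the degree to at most \<open>2 * (d - 1)\<close> and
    puts the large value \<open>poly R 0\<close> at the centre \<open>k = d\<close>.\<close>
  define S where "S = R \<circ>\<^sub>p ([:0, 0, 4:] \<circ>\<^sub>p [:- real d, 1:])"
  have S_eval: "poly S (real k) = poly R (4 * (real k - real d)\<^sup>2)" for k
    unfolding S_def by (simp add: poly_pcompose power2_eq_square algebra_simps)
  have "degree S = degree R * 2" unfolding S_def by (simp add: degree_pcompose)
  then have "degree S < 2 * d" using degR d by simp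
  from alternating_binomial_sum_poly_eq_0[OF this]
  have "(\<Sum>k\<le>2 * d. (-1) ^ k * real (2 * d choose k) * poly S (real k)) = 0" .
  then have "(-1) ^ d * real (2 * d choose d) * poly S (real d) =
      - (\<Sum>k\<in>{..2 * d} - {d}. (-1) ^ k * real (2 * d choose k) * poly S (real k))"
    by (subst (asm) sum.remove[of _ d]) auto
  then have "\<bar>(-1) ^ d * real (2 * d choose d) * poly S (real d)\<bar> =
      \<bar>\<Sum>k\<in>{..2 * d} - {d}. (-1) ^ k * real (2 * d choose k) * poly S (real k)\<bar>" by simp
  also have "\<dots> \<le> (\<Sum>k\<in>{..2 * d} - {d}. \<bar>(-1) ^ k * real (2 * d choose k) * poly S (real k)\<bar>)"
    by (rule sum_abs)
  also have "\<dots> \<le> (\<Sum>k\<in>{..2 * d} - {d}. real (2 * d choose d) * (2 / 3 * (1 / (4 * (real k - real d)\<^sup>2 - 1))))"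
  proof (rule sum_mono)
    fix k assume k: "k \<in> {..2 * d} - {d}"
    \<comment> \<open>The point \<open>4 * i\<^sup>2\<close> is at most
      \<open>4 * d\<^sup>2 < s\<close>, so \<open>q\<close> is small there, and \<open>R\<close> is
      a difference quotient of two small values of \<open>q\<close>.\<close>
    define i where "i = nat \<bar>int k - int d\<bar>"
    have i: "1 \<le> i" "i \<le> d" using k unfolding i_def by auto
    have "real i = \<bar>real k - real d\<bar>" unfolding i_def by simp
    then have i2: "4 * (real k - real d)\<^sup>2 = real (4 * i\<^sup>2)" by simp
    have "4 * i\<^sup>2 \<le> 4 * d\<^sup>2" using i(2) by (simp add: power_mono)
    then have "4 * i\<^sup>2 \<le> s" using s by linarith
    moreover have i1: "1 \<le> i\<^sup>2" using i(1) by simp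
    ultimately have "\<bar>poly q (real (4 * i\<^sup>2))\<bar> \<le> 1 / 3" by (intro small) linarith+
    then have "\<bar>poly q (real (4 * i\<^sup>2)) - poly q 1\<bar> \<le> 2 / 3" using q1 by linarith
    moreover have pos: "0 < real (4 * i\<^sup>2) - 1" using i1 by linarith
    ultimately have "(real (4 * i\<^sup>2) - 1) * \<bar>poly R (real (4 * i\<^sup>2))\<bar> \<le> 2 / 3"
      unfolding R_eval[symmetric] by (simp add: abs_mult)
    then have "\<bar>poly R (real (4 * i\<^sup>2))\<bar> \<le> 2 / 3 * (1 / (real (4 * i\<^sup>2) - 1))"
      using pos_le_divide_eq[OF pos, of "\<bar>poly R (real (4 * i\<^sup>2))\<bar>" "2 / 3"] by (simp add: mult.commute)
    moreover have "real (2 * d choose k) \<le> real (2 * d choose d)"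
      using binomial_maximum'[of d k] by simp
    ultimately show "\<bar>(-1) ^ k * real (2 * d choose k) * poly S (real k)\<bar>
        \<le> real (2 * d choose d) * (2 / 3 * (1 / (4 * (real k - real d)\<^sup>2 - 1)))"
      unfolding S_eval i2 by (simp only: abs_mult power_abs abs_minus abs_one power_one mult_1_left
          abs_of_nat) (intro mult_mono, auto)
  qed
  also have "\<dots> = real (2 * d choose d) * (2 / 3 * (\<Sum>k\<in>{..2 * d} - {d}. 1 / (4 * (real k - real d)\<^sup>2 - 1)))"
    by (simp only: sum_distrib_left)
  \<comment> \<open>Removing the central term \<open>-1\<close> from the telescoped sum leaves a
    value strictly below \<open>1\<close>, while the size of \<open>poly R 0\<close> is at least
    \<open>1 - 1 / 3\<close>.\<close>
  also have "(\<Sum>k\<in>{..2 * d} - {d}. 1 / (4 * (real k - real d)\<^sup>2 - 1)) = 1 - 1 / (2 * real d + 1)"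
    using sum.remove[of "{..2 * d}" d "\<lambda>k. 1 / (4 * (real k - real d)\<^sup>2 - 1)"]
      sum_inverse_four_square_minus_one[of d] by simp
  finally have "real (2 * d choose d) * \<bar>poly R 0\<bar> \<le> real (2 * d choose d) * (2 / 3 * (1 - 1 / (2 * real d + 1)))"
    unfolding S_eval by (simp add: abs_mult power_abs)
  then have "\<bar>poly R 0\<bar> \<le> 2 / 3 * (1 - 1 / (2 * real d + 1))"
    by (simp add: zero_less_binomial)
  also have "\<dots> < 2 / 3" by simp
  also have "2 / 3 \<le> \<bar>poly R 0\<bar>" using R_eval[of 0] large q1 by simp
  finally show False by simp
qed

section \<open>Symmetrization\<close>

definition choose_poly :: "nat \<Rightarrow> real poly" where
  "choose_poly e = smult (1 / fact e) (\<Prod>i<e. [:- real i, 1:])"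

lemma poly_choose_poly: "poly (choose_poly e) (real j) = real (j choose e)"
  by (simp add: choose_poly_def poly_prod binomial_gbinomial gbinomial_prod_rev atLeast0LessThan)

lemma degree_choose_poly: "degree (choose_poly e) \<le> e"
proof -
  have "degree (\<Prod>i<e. [:- real i, 1:]) \<le> (\<Sum>i<e. degree [:- real i, 1:])"
    using degree_prod_sum_le[of "{..<e}" "\<lambda>i. [:- real i, 1:]"] by (simp add: comp_def)
  then show ?thesis by (simp add: choose_poly_def)
qed

text \<open>Deleting \<open>S\<close> leaves the subsets of \<open>T - S\<close> of size
  \<open>j - card S\<close>; the product form avoids division in the natural numbers.\<close>

lemma card_supersets:
  assumes "finite T" "S \<subseteq> T" "j \<le> card T"
  shows "card {W. W \<subseteq> T \<and> card W = j \<and> S \<subseteq> W} * (card T choose card S) = (card T choose j) * (j choose card S)"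
proof (cases "card S \<le> j")
  case False
  have "{W. W \<subseteq> T \<and> card W = j \<and> S \<subseteq> W} = {}"
    using False assms(1) by (auto dest: card_mono finite_subset)
  then show ?thesis using False by (simp only: card.empty) (simp add: binomial_eq_0)
next
  case True
  have finS: "finite S" using assms finite_subset by blast
  have "bij_betw (\<lambda>W. W - S) {W. W \<subseteq> T \<and> card W = j \<and> S \<subseteq> W} {W. W \<subseteq> T - S \<and> card W = j - card S}"
  proof (rule bij_betw_byWitness[where f' = "\<lambda>W. W \<union> S"])
    show "(\<lambda>W. W - S) ` {W. W \<subseteq> T \<and> card W = j \<and> S \<subseteq> W} \<subseteq> {W. W \<subseteq> T - S \<and> card W = j - card S}"
      using finS by (auto simp: card_Diff_subset)
    show "(\<lambda>W. W \<union> S) ` {W. W \<subseteq> T - S \<and> card W = j - card S} \<subseteq> {W. W \<subseteq> T \<and> card W = j \<and> S \<subseteq> W}"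
    proof (rule image_subsetI)
      fix W assume "W \<in> {W. W \<subseteq> T - S \<and> card W = j - card S}"
      then have W: "W \<subseteq> T - S" "card W = j - card S" by auto
      have "finite W" using W(1) assms(1) finite_subset by blast
      moreover have "W \<inter> S = {}" using W(1) by blast
      ultimately have "card (W \<union> S) = j" using W(2) True finS by (simp add: card_Un_disjoint)
      then show "W \<union> S \<in> {W. W \<subseteq> T \<and> card W = j \<and> S \<subseteq> W}" using W(1) assms(2) by auto
    qed
  qed auto
  then have "card {W. W \<subseteq> T \<and> card W = j \<and> S \<subseteq> W} = card {W. W \<subseteq> T - S \<and> card W = j - card S}"
    by (rule bij_betw_same_card)
  also have "\<dots> = (card T - card S) choose (j - card S)"
    using n_subsets[of "T - S" "j - card S"] assms finS by (simp add: card_Diff_subset)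
  finally show ?thesis using choose_mult[OF True assms(3)] by (simp add: mult.commute)
qed

text \<open>The average of a monomial with support \<open>S\<close> over the
  \<open>j\<close>-subsets of \<open>T\<close> is
  \<open>(j choose card S) / (card T choose card S)\<close>, a polynomial in \<open>j\<close> of
  degree \<open>card S\<close>.\<close>

lemma symmetrization:
  fixes c :: "'b \<Rightarrow> real" and S :: "'b \<Rightarrow> 'a set"
  assumes T: "finite T" and A: "finite A" and S: "\<And>a. a \<in> A \<Longrightarrow> S a \<subseteq> T \<and> card (S a) \<le> d"
  shows "\<exists>q. degree q \<le> d \<and> (\<forall>j\<le>card T. real (card T choose j) * poly q (real j) =
     (\<Sum>W | W \<subseteq> T \<and> card W = j. \<Sum>a\<in>A. c a * of_bool (S a \<subseteq> W)))"
proof -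
  define q where "q = (\<Sum>a\<in>A. smult (c a / real (card T choose card (S a))) (choose_poly (card (S a))))"
  have "degree q \<le> d" unfolding q_def
  proof (rule degree_sum_le[OF A])
    fix a assume "a \<in> A"
    then show "degree (smult (c a / real (card T choose card (S a))) (choose_poly (card (S a)))) \<le> d"
      using S[of a] degree_choose_poly[of "card (S a)"]
        degree_smult_le[of "c a / real (card T choose card (S a))" "choose_poly (card (S a))"] by linarith
  qed
  moreover have "real (card T choose j) * poly q (real j) =
     (\<Sum>W | W \<subseteq> T \<and> card W = j. \<Sum>a\<in>A. c a * of_bool (S a \<subseteq> W))" if j: "j \<le> card T" for j
  proof -
    have fin: "finite {W. W \<subseteq> T \<and> card W = j}" by (rule finite_subset[of _ "Pow T"]) (use T in auto)
    have "(\<Sum>W | W \<subseteq> T \<and> card W = j. \<Sum>a\<in>A. c a * of_bool (S a \<subseteq> W)) =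
        (\<Sum>a\<in>A. \<Sum>W | W \<subseteq> T \<and> card W = j. c a * of_bool (S a \<subseteq> W))" by (rule sum.swap)
    also have "\<dots> = (\<Sum>a\<in>A. real (card T choose j) *
        (c a / real (card T choose card (S a)) * real (j choose card (S a))))"
    proof (rule sum.cong[OF refl])
      fix a assume a: "a \<in> A"
      have "(\<Sum>W | W \<subseteq> T \<and> card W = j. c a * of_bool (S a \<subseteq> W)) =
          c a * real (card {W. W \<subseteq> T \<and> card W = j \<and> S a \<subseteq> W})"
        using fin by (simp add: sum_distrib_left[symmetric] sum_of_bool_eq Int_def conj_assoc)
      moreover have "real (card {W. W \<subseteq> T \<and> card W = j \<and> S a \<subseteq> W}) * real (card T choose card (S a)) =
          real (card T choose j) * real (j choose card (S a))"
        using card_supersets[OF T _ j, of "S a"] S[OF a] by (metis of_nat_mult)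
      moreover have "real (card T choose card (S a)) > 0"
        using S[OF a] T by (simp add: zero_less_binomial card_mono)
      ultimately show "(\<Sum>W | W \<subseteq> T \<and> card W = j. c a * of_bool (S a \<subseteq> W)) = real (card T choose j) *
        (c a / real (card T choose card (S a)) * real (j choose card (S a)))"
        by (simp add: field_simps)
    qed
    also have "\<dots> = real (card T choose j) * poly q (real j)"
      by (simp add: q_def poly_sum poly_choose_poly sum_distrib_left)
    finally show ?thesis by simp
  qed
  ultimately show ?thesis by blast
qed

section \<open>The Boolean cube\<close>

definition point :: "nat \<Rightarrow> nat set \<Rightarrow> bool list" where
  "point n S = map (\<lambda>i. i \<in> S) [0..<n]"

lemma point_in_cube [simp]: "point n S \<in> cube n"
  by (simp add: point_def cube_def)

lemma length_point [simp]: "length (point n S) = n"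
  by (simp add: point_def)

lemma nth_point [simp]: "i < n \<Longrightarrow> point n S ! i = (i \<in> S)"
  by (simp add: point_def)

lemma point_ones: "x \<in> cube n \<Longrightarrow> point n {i. i < n \<and> x ! i} = x"
  by (auto simp: cube_def intro: nth_equalityI)

section \<open>Polynomials on the cube\<close>

lemma prod_of_bool_power:
  fixes n :: nat
  shows "(\<Prod>i<n. (of_bool (P i) :: real) ^ (\<alpha> i)) = of_bool (\<forall>i<n. \<alpha> i \<noteq> (0::nat) \<longrightarrow> P i)"
  by (induction n) (auto simp: less_Suc_eq)

text \<open>Existence of the Moebius inverse. For a new element \<open>v\<close>, sets without
  \<open>v\<close> get the coefficients of \<open>g\<close>, sets with \<open>v\<close> those of the
  difference of \<open>g\<close> in direction \<open>v\<close>.\<close>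

lemma subset_sum_representation:
  fixes g :: "'a set \<Rightarrow> real"
  assumes "finite V"
  shows "\<exists>c. \<forall>T\<subseteq>V. g T = (\<Sum>S\<in>Pow T. c S)"
  using assms
proof (induction V arbitrary: g rule: finite_induct)
  case empty
  show ?case by (rule exI[of _ g]) simp
next
  case (insert v V)
  obtain c1 where c1: "\<And>T. T \<subseteq> V \<Longrightarrow> g T = (\<Sum>S\<in>Pow T. c1 S)"
    using insert.IH[of g] by blast
  obtain c2 where c2: "\<And>T. T \<subseteq> V \<Longrightarrow> g (insert v T) - g T = (\<Sum>S\<in>Pow T. c2 S)"
    using insert.IH[of "\<lambda>T. g (insert v T) - g T"] by blast
  define c where "c S = (if v \<in> S then c2 (S - {v}) else c1 S)" for S
  have low: "(\<Sum>S\<in>Pow T. c S) = g T" if "T \<subseteq> V" for T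
  proof -
    have "(\<Sum>S\<in>Pow T. c S) = (\<Sum>S\<in>Pow T. c1 S)"
      using that insert.hyps(2) by (intro sum.cong) (auto simp: c_def)
    then show ?thesis using c1[OF that] by simp
  qed
  have "g T = (\<Sum>S\<in>Pow T. c S)" if T: "T \<subseteq> insert v V" for T
  proof (cases "v \<in> T")
    case False
    then have "T \<subseteq> V" using T by blast
    then show ?thesis using low by simp
  next
    case True
    define R where "R = T - {v}"
    have R: "R \<subseteq> V" "T = insert v R" "v \<notin> R" using T True unfolding R_def by auto
    have finR: "finite R" using R(1) insert.hyps(1) finite_subset by blast
    have "(\<Sum>S\<in>Pow T. c S) = (\<Sum>S\<in>Pow R. c S) + (\<Sum>S\<in>insert v ` Pow R. c S)"
      unfolding R(2) Pow_insert using finR R(3) by (intro sum.union_disjoint) auto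
    also have "(\<Sum>S\<in>insert v ` Pow R. c S) = (\<Sum>S\<in>Pow R. c (insert v S))"
    proof (rule sum.reindex_cong[of "insert v"])
      show "inj_on (insert v) (Pow R)" using R(3) by (auto simp: inj_on_def)
    qed auto
    also have "\<dots> = (\<Sum>S\<in>Pow R. c2 S)" using R(3) by (intro sum.cong) (auto simp: c_def intro!: arg_cong[where f = c2])
    finally show ?thesis using low[OF R(1)] c2[OF R(1)] R(2) by simp
  qed
  then show ?case by blast
qed

text \<open>Every function on the cube is multilinear. This guarantees that the minimum in
  \<open>Ndeg\<close> is attained.\<close>

lemma poly_deg_le_top: "poly_deg_le n n p"
proof -
  obtain c where c: "\<And>T. T \<subseteq> {..<n} \<Longrightarrow> p (point n T) = (\<Sum>S\<in>Pow T. c S)"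
    using subset_sum_representation[of "{..<n}" "\<lambda>T. p (point n T)"] by auto
  let ?m = "\<lambda>(S::nat set) i. of_bool (i \<in> S) :: nat"
  let ?A = "?m ` Pow {..<n}"
  have inj: "inj_on ?m (Pow {..<n})"
  proof (rule inj_onI)
    fix S T assume "?m S = ?m T"
    then have "i \<in> S \<longleftrightarrow> i \<in> T" for i by (metis of_bool_eq_iff)
    then show "S = T" by blast
  qed
  have "p x = (\<Sum>\<alpha>\<in>?A. c {i. \<alpha> i \<noteq> 0} * (\<Prod>i<n. (of_bool (x ! i) :: real) ^ (\<alpha> i)))" if x: "x \<in> cube n" for x
  proof -
    let ?T = "{i. i < n \<and> x ! i}"
    have "(\<Sum>\<alpha>\<in>?A. c {i. \<alpha> i \<noteq> 0} * (\<Prod>i<n. (of_bool (x ! i) :: real) ^ (\<alpha> i))) =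
        (\<Sum>S\<in>Pow {..<n}. c S * of_bool (\<forall>i<n. i \<in> S \<longrightarrow> x ! i))"
      unfolding sum.reindex[OF inj] by (simp add: prod_of_bool_power)
    also have "\<dots> = (\<Sum>S\<in>Pow ?T. c S)"
      by (rule sum.mono_neutral_cong_right) auto
    also have "\<dots> = p x" using c[of ?T] point_ones[OF x] by (simp add: subset_eq)
    finally show ?thesis by simp
  qed
  moreover have "(\<Sum>i<n. ?m S i) \<le> n" for S
    using sum_mono[of "{..<n}" "?m S" "\<lambda>_. 1"] by simp
  moreover have "finite ?A" by simp
  ultimately show ?thesis unfolding poly_deg_le_def
    by (intro exI[of _ ?A] exI[of _ "\<lambda>\<alpha>. c {i. \<alpha> i \<noteq> 0}"]) auto
qed

lemma Ndeg_witness: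
  obtains p where "poly_deg_le n (Ndeg n f) p"
    "\<And>x. x \<in> cube n \<Longrightarrow> \<not> f x \<Longrightarrow> \<bar>p x\<bar> \<le> 1 / 3"
    "\<And>x. x \<in> cube n \<Longrightarrow> f x \<Longrightarrow> 1 \<le> \<bar>p x\<bar>"
proof -
  let ?P = "\<lambda>d. \<exists>p. poly_deg_le n d p \<and>
      (\<forall>x\<in>cube n. (\<not> f x \<longrightarrow> \<bar>p x\<bar> \<le> 1/3) \<and> (f x \<longrightarrow> \<bar>p x\<bar> \<ge> 1))"
  have "?P n" using poly_deg_le_top[of n "\<lambda>x. of_bool (f x)"]
    by (intro exI[of _ "\<lambda>x. of_bool (f x)"]) simp
  then have "?P (Ndeg n f)" unfolding Ndeg_def by (rule LeastI[of ?P])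
  then show ?thesis using that by blast
qed

lemma poly_deg_le_symmetrization:
  assumes p: "poly_deg_le n d p" and MX: "M \<subseteq> X" "X \<subseteq> {..<n}"
  shows "\<exists>q. degree q \<le> d \<and> (\<forall>j\<le>card (X - M). real (card (X - M) choose j) * poly q (real j) =
     (\<Sum>W | W \<subseteq> X - M \<and> card W = j. p (point n (M \<union> W))))"
proof -
  obtain A c where A: "finite A" "\<And>\<alpha>. \<alpha> \<in> A \<Longrightarrow> (\<Sum>i<n. \<alpha> i) \<le> d"
    "\<And>x. x \<in> cube n \<Longrightarrow> p x = (\<Sum>\<alpha>\<in>A. c \<alpha> * (\<Prod>i<n. (of_bool (x ! i) :: real) ^ (\<alpha> i)))"
    using p unfolding poly_deg_le_def by blast
  define supp where "supp \<alpha> = {i. i < n \<and> \<alpha> i \<noteq> (0::nat)}" for \<alpha>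
  \<comment> \<open>On \<open>[M, X]\<close> the variables outside \<open>X\<close> are
    \<open>0\<close> and kill all other monomials, while those in \<open>M\<close> are
    \<open>1\<close> and drop out of the supports.\<close>
  define B where "B = {\<alpha> \<in> A. supp \<alpha> \<subseteq> X}"
  have supp: "card (supp \<alpha>) \<le> d" if "\<alpha> \<in> A" for \<alpha>
  proof -
    have "card (supp \<alpha>) = (\<Sum>i\<in>supp \<alpha>. 1)" by simp
    also have "\<dots> \<le> (\<Sum>i\<in>supp \<alpha>. \<alpha> i)" by (rule sum_mono) (auto simp: supp_def)
    also have "\<dots> \<le> (\<Sum>i<n. \<alpha> i)" by (rule sum_mono2) (auto simp: supp_def)
    also have "\<dots> \<le> d" by (rule A(2)[OF that])
    finally show ?thesis .
  qed
  have p_eq: "p (point n (M \<union> W)) = (\<Sum>\<alpha>\<in>B. c \<alpha> * of_bool (supp \<alpha> - M \<subseteq> W))" if W: "W \<subseteq> X - M" for W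
  proof -
    have "p (point n (M \<union> W)) = (\<Sum>\<alpha>\<in>A. c \<alpha> * of_bool (supp \<alpha> - M \<subseteq> W))"
      unfolding A(3)[OF point_in_cube] prod_of_bool_power
      by (intro sum.cong refl arg_cong[where f = "\<lambda>b. _ * of_bool b"]) (auto simp: supp_def)
    also have "\<dots> = (\<Sum>\<alpha>\<in>B. c \<alpha> * of_bool (supp \<alpha> - M \<subseteq> W))"
      using W MX(1) A(1) by (intro sum.mono_neutral_right) (auto simp: B_def)
    finally show ?thesis .
  qed
  have fin: "finite (X - M)" using MX(2) finite_subset by blast
  have "finite B" using A(1) by (simp add: B_def)
  moreover have "supp \<alpha> - M \<subseteq> X - M \<and> card (supp \<alpha> - M) \<le> d" if "\<alpha> \<in> B" for \<alpha>
  proof -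
    have "card (supp \<alpha> - M) \<le> card (supp \<alpha>)" by (rule card_mono) (auto simp: supp_def)
    then show ?thesis using supp[of \<alpha>] that by (auto simp: B_def)
  qed
  ultimately obtain q where "degree q \<le> d" "\<forall>j\<le>card (X - M). real (card (X - M) choose j) * poly q (real j) =
     (\<Sum>W | W \<subseteq> X - M \<and> card W = j. \<Sum>\<alpha>\<in>B. c \<alpha> * of_bool (supp \<alpha> - M \<subseteq> W))"
    using symmetrization[OF fin, of B "\<lambda>\<alpha>. supp \<alpha> - M" d c] by blast
  then show ?thesis using p_eq by (intro exI[of _ q]) simp
qed

text \<open>The symmetrized \<open>q\<close> at \<open>j\<close> averages \<open>p\<close> over
  level \<open>j\<close> of \<open>[M, X]\<close>. It is therefore large at the level of the
  exceptional end and small at all others.\<close>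

lemma interval_card_le_of_poly:
  assumes p: "poly_deg_le n d p"
    and small: "\<And>x. x \<in> cube n \<Longrightarrow> \<not> f x \<Longrightarrow> \<bar>p x\<bar> \<le> 1 / 3"
    and large: "\<And>x. x \<in> cube n \<Longrightarrow> f x \<Longrightarrow> 1 \<le> \<bar>p x\<bar>"
    and MX: "M \<subseteq> X" "X \<subseteq> {..<n}"
    and iso: "f (point n M) \<and> (\<forall>Z. M \<subset> Z \<longrightarrow> Z \<subseteq> X \<longrightarrow> \<not> f (point n Z)) \<or>
              f (point n X) \<and> (\<forall>Z. M \<subseteq> Z \<longrightarrow> Z \<subset> X \<longrightarrow> \<not> f (point n Z))"
  shows "card (X - M) \<le> 4 * d\<^sup>2"
proof -
  define s where "s = card (X - M)"
  have fin: "finite (X - M)" using MX(2) finite_subset by blast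
  obtain q where q: "degree q \<le> d" "\<And>j. j \<le> s \<Longrightarrow> real (s choose j) * poly q (real j) =
     (\<Sum>W | W \<subseteq> X - M \<and> card W = j. p (point n (M \<union> W)))"
    using poly_deg_le_symmetrization[OF p MX] unfolding s_def by blast
  have q_small: "\<bar>poly q (real j)\<bar> \<le> 1 / 3"
    if j: "j \<le> s" and W: "\<And>W. W \<subseteq> X - M \<Longrightarrow> card W = j \<Longrightarrow> \<not> f (point n (M \<union> W))" for j
  proof -
    have "real (s choose j) * \<bar>poly q (real j)\<bar> = \<bar>\<Sum>W | W \<subseteq> X - M \<and> card W = j. p (point n (M \<union> W))\<bar>"
      using arg_cong[OF q(2)[OF j], of abs] by (simp add: abs_mult)
    also have "\<dots> \<le> (\<Sum>W | W \<subseteq> X - M \<and> card W = j. \<bar>p (point n (M \<union> W))\<bar>)" by (rule sum_abs)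
    also have "\<dots> \<le> (\<Sum>W | W \<subseteq> X - M \<and> card W = j. 1 / 3)"
      by (intro sum_mono small point_in_cube W) auto
    also have "\<dots> = real (s choose j) * (1 / 3)" using n_subsets[OF fin, of j] by (simp add: s_def)
    finally show ?thesis using j by (simp add: zero_less_binomial)
  qed
  have "{W. W \<subseteq> X - M \<and> card W = 0} = {{}}" using fin by (auto dest: finite_subset)
  then have q0: "poly q 0 = p (point n M)" using q(2)[of 0] by simp
  have "{W. W \<subseteq> X - M \<and> card W = s} = {X - M}" unfolding s_def using fin by (auto dest: card_subset_eq)
  moreover have "M \<union> (X - M) = X" using MX(1) by blast
  ultimately have qs: "poly q (real s) = p (point n X)" using q(2)[of s] by simp
  from iso have "s \<le> 4 * d\<^sup>2"
  proof (elim disjE conjE)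
    assume M: "f (point n M)" and iso: "\<forall>Z. M \<subset> Z \<longrightarrow> Z \<subseteq> X \<longrightarrow> \<not> f (point n Z)"
    have "\<bar>poly q (real j)\<bar> \<le> 1 / 3" if j: "1 \<le> j" "j \<le> s" for j
    proof (rule q_small[OF j(2)])
      fix W assume W: "W \<subseteq> X - M" "card W = j"
      then have "W \<noteq> {}" using j(1) by auto
      then have "M \<subset> M \<union> W" "M \<union> W \<subseteq> X" using W(1) MX(1) by auto
      then show "\<not> f (point n (M \<union> W))" using iso by blast
    qed
    moreover have "1 \<le> \<bar>poly q 0\<bar>" unfolding q0 using M by (intro large) auto
    ultimately show ?thesis using poly_isolated_large_value[OF q(1)] by blast
  next
    assume X: "f (point n X)" and iso: "\<forall>Z. M \<subseteq> Z \<longrightarrow> Z \<subset> X \<longrightarrow> \<not> f (point n Z)"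
    \<comment> \<open>Reversing the levels moves the exceptional top to \<open>0\<close>.\<close>
    let ?r = "q \<circ>\<^sub>p [:real s, -1:]"
    have "degree ?r \<le> d" using q(1) by (simp add: degree_pcompose)
    moreover have "\<bar>poly ?r (real j)\<bar> \<le> 1 / 3" if j: "1 \<le> j" "j \<le> s" for j
    proof -
      have "\<bar>poly q (real (s - j))\<bar> \<le> 1 / 3"
      proof (rule q_small)
        fix W assume W: "W \<subseteq> X - M" "card W = s - j"
        have "W \<noteq> X - M" using W(2) j unfolding s_def by auto
        then have "M \<union> W \<subset> X" using W(1) MX(1) by blast
        then show "\<not> f (point n (M \<union> W))" using iso by blast
      qed simp
      then show ?thesis using j(2) by (simp add: poly_pcompose of_nat_diff)
    qed
    moreover have "1 \<le> \<bar>poly ?r 0\<bar>" using large[of "point n X"] X qs by (simp add: poly_pcompose)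
    ultimately show ?thesis using poly_isolated_large_value[of ?r d s] by blast
  qed
  then show ?thesis by (simp add: s_def)
qed

text \<open>Either \<open>f\<close> or its negation is true at the exceptional end and false on the
  rest of the interval; which one depends on the value there, hence the maximum.\<close>

lemma point_interval_bound_Ndeg:
  "point_interval_bound {..<n} (\<lambda>S. f (point n S)) (4 * max ((Ndeg n f)\<^sup>2) ((Ndeg n (\<lambda>x. \<not> f x))\<^sup>2))"
  unfolding point_interval_bound_def
proof (intro allI impI)
  fix M X
  assume MX: "M \<subseteq> X" "X \<subseteq> {..<n}"
    and iso: "(\<forall>Z. M \<subseteq> Z \<longrightarrow> Z \<subset> X \<longrightarrow> f (point n Z) \<noteq> f (point n X)) \<or>
              (\<forall>Z. M \<subset> Z \<longrightarrow> Z \<subseteq> X \<longrightarrow> f (point n Z) \<noteq> f (point n M))"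
  have bound: "card (X - M) \<le> 4 * (Ndeg n g)\<^sup>2"
    if "g (point n M) \<and> (\<forall>Z. M \<subset> Z \<longrightarrow> Z \<subseteq> X \<longrightarrow> \<not> g (point n Z)) \<or>
        g (point n X) \<and> (\<forall>Z. M \<subseteq> Z \<longrightarrow> Z \<subset> X \<longrightarrow> \<not> g (point n Z))" for g
  proof -
    obtain p where p: "poly_deg_le n (Ndeg n g) p"
      "\<And>x. x \<in> cube n \<Longrightarrow> \<not> g x \<Longrightarrow> \<bar>p x\<bar> \<le> 1 / 3" "\<And>x. x \<in> cube n \<Longrightarrow> g x \<Longrightarrow> 1 \<le> \<bar>p x\<bar>"
      using Ndeg_witness[of n g] by metis
    show ?thesis by (rule interval_card_le_of_poly[OF p MX that])
  qed
  have "card (X - M) \<le> 4 * (Ndeg n f)\<^sup>2 \<or> card (X - M) \<le> 4 * (Ndeg n (\<lambda>x. \<not> f x))\<^sup>2"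
    using iso
  proof
    assume *: "\<forall>Z. M \<subseteq> Z \<longrightarrow> Z \<subset> X \<longrightarrow> f (point n Z) \<noteq> f (point n X)"
    then show ?thesis using bound[of f] bound[of "\<lambda>x. \<not> f x"] by (cases "f (point n X)") auto
  next
    assume *: "\<forall>Z. M \<subset> Z \<longrightarrow> Z \<subseteq> X \<longrightarrow> f (point n Z) \<noteq> f (point n M)"
    then show ?thesis using bound[of f] bound[of "\<lambda>x. \<not> f x"] by (cases "f (point n M)") auto
  qed
  then show "card (X - M) \<le> 4 * max ((Ndeg n f)\<^sup>2) ((Ndeg n (\<lambda>x. \<not> f x))\<^sup>2)"
    by linarith
qed

section \<open>From chains of sets to monotone paths\<close>

lemma alternation_append:
  assumes "ps \<noteq> []"
  shows "alternation f (ps @ [y]) = alternation f ps + of_bool (f (last ps) \<noteq> f y)"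
proof -
  let ?A = "{i. Suc i < length ps \<and> f (ps ! i) \<noteq> f (ps ! Suc i)}"
  let ?B = "if f (last ps) \<noteq> f y then {length ps - 1} else {}"
  have len: "0 < length ps" using assms by simp
  have "{i. Suc i < length (ps @ [y]) \<and> f ((ps @ [y]) ! i) \<noteq> f ((ps @ [y]) ! Suc i)} = ?A \<union> ?B"
  proof (rule set_eqI)
    fix i
    consider "Suc i < length ps" | "Suc i = length ps" | "length ps < Suc i" by linarith
    then show "i \<in> {i. Suc i < length (ps @ [y]) \<and> f ((ps @ [y]) ! i) \<noteq> f ((ps @ [y]) ! Suc i)} \<longleftrightarrow> i \<in> ?A \<union> ?B"
    proof cases
      case 2
      then have "i = length ps - 1" by simp
      then show ?thesis using 2 assms by (simp add: nth_append last_conv_nth)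
    qed (use len in \<open>auto simp: nth_append\<close>)
  qed
  moreover have "finite ?A" by (rule finite_subset[of _ "{..<length ps}"]) auto
  moreover have "?A \<inter> ?B = {}" using len by auto
  ultimately show ?thesis unfolding alternation_def by (simp add: card_Un_disjoint)
qed

text \<open>An initial segment of a monotone path, so that it can grow point by point. It asks for
  at least \<open>m\<close> alternations because filling in skipped levels may create more.\<close>

definition reaches :: "nat \<Rightarrow> (bool list \<Rightarrow> bool) \<Rightarrow> nat \<Rightarrow> nat set \<Rightarrow> bool" where
  "reaches n f m S \<longleftrightarrow> (\<exists>ps. ps \<noteq> [] \<and> hd ps = replicate n False \<and> last ps = point n S \<and>
     (\<forall>i. Suc i < length ps \<longrightarrow> (\<exists>j<n. \<not> (ps ! i) ! j \<and> ps ! Suc i = (ps ! i)[j := True])) \<and>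
     m \<le> alternation f ps)"

lemma reaches_mono: "reaches n f m S \<Longrightarrow> m' \<le> m \<Longrightarrow> reaches n f m' S"
  unfolding reaches_def by (meson order_trans)

lemma reaches_empty: "reaches n f 0 {}"
proof -
  have "point n {} = replicate n False" by (intro nth_equalityI) auto
  then show ?thesis unfolding reaches_def by (intro exI[of _ "[replicate n False]"]) simp
qed

lemma reaches_insert:
  assumes "reaches n f m S" "j < n" "j \<notin> S"
  shows "reaches n f (m + of_bool (f (point n S) \<noteq> f (point n (insert j S)))) (insert j S)"
proof -
  obtain ps where ps: "ps \<noteq> []" "hd ps = replicate n False" "last ps = point n S"
    "\<And>i. Suc i < length ps \<Longrightarrow> \<exists>j<n. \<not> (ps ! i) ! j \<and> ps ! Suc i = (ps ! i)[j := True]"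
    "m \<le> alternation f ps"
    using assms(1) unfolding reaches_def by blast
  let ?y = "point n (insert j S)"
  have y: "?y = (point n S)[j := True]" using assms(2) by (intro nth_equalityI) (auto simp: nth_list_update)
  have "\<exists>j<n. \<not> ((ps @ [?y]) ! i) ! j \<and> (ps @ [?y]) ! Suc i = ((ps @ [?y]) ! i)[j := True]"
    if i: "Suc i < length (ps @ [?y])" for i
  proof (cases "Suc i < length ps")
    case True
    then show ?thesis using ps(4)[OF True] by (simp add: nth_append)
  next
    case False
    then have len: "Suc i = length ps" using i by simp
    then have "i = length ps - 1" by simp
    then have "ps ! i = point n S" "(ps @ [?y]) ! Suc i = ?y" "(ps @ [?y]) ! i = ps ! i"
      using ps(1,3) len by (auto simp: last_conv_nth nth_append)
    then show ?thesis using y assms(2,3) by (intro exI[of _ j]) simp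
  qed
  then show ?thesis unfolding reaches_def using ps
    by (intro exI[of _ "ps @ [?y]"]) (auto simp: alternation_append)
qed

lemma reaches_union:
  assumes "finite R" "reaches n f m S" "R \<subseteq> {..<n}" "R \<inter> S = {}"
  shows "reaches n f (m + of_bool (f (point n S) \<noteq> f (point n (S \<union> R)))) (S \<union> R)"
  using assms
proof (induction R rule: finite_induct)
  case (insert j R)
  have "reaches n f (m + of_bool (f (point n S) \<noteq> f (point n (S \<union> R)))) (S \<union> R)"
    using insert by auto
  from reaches_insert[OF this, of j] insert.prems insert.hyps
  have "reaches n f (m + of_bool (f (point n S) \<noteq> f (point n (S \<union> R))) +
      of_bool (f (point n (S \<union> R)) \<noteq> f (point n (S \<union> insert j R)))) (S \<union> insert j R)"
    by auto
  \<comment> \<open>If the value differs across the whole step, it differs across one of its two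
    parts.\<close>
  then show ?case by (rule reaches_mono) auto
qed simp

lemma reaches_alternates:
  assumes "alternates (\<lambda>S. f (point n S)) m A B" "reaches n f 0 A" "B \<subseteq> {..<n}"
  shows "reaches n f m B"
  using assms
proof (induction rule: alternates.induct)
  case (extend m A B C)
  have "B \<union> (C - B) = C" using extend.hyps by blast
  moreover have "finite (C - B)" using extend.prems finite_subset by blast
  ultimately show ?case
    using reaches_union[of "C - B" n f m B] extend by fastforce
qed simp

lemma monotone_path_length:
  assumes "monotone_path n ps"
  shows "length ps \<le> Suc n"
proof -
  have step: "\<exists>j<n. \<not> (ps ! i) ! j \<and> ps ! Suc i = (ps ! i)[j := True]" if "Suc i < length ps" for i
    using assms that unfolding monotone_path_def by blast
  have ne: "ps \<noteq> []" and hd: "hd ps = replicate n False" using assms unfolding monotone_path_def by auto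
  \<comment> \<open>Each step adds a new one, so a path has at most \<open>Suc n\<close> points;
    this makes the set under \<open>Max\<close> in \<open>alt\<close> finite.\<close>
  have "length (ps ! i) = n \<and> i \<le> card {j. j < n \<and> ps ! i ! j}" if "i < length ps" for i
    using that
  proof (induction i)
    case 0
    then show ?case using hd ne by (simp add: hd_conv_nth)
  next
    case (Suc i)
    then obtain j where j: "j < n" "\<not> (ps ! i) ! j" "ps ! Suc i = (ps ! i)[j := True]"
      using step by blast
    have IH: "length (ps ! i) = n" "i \<le> card {j. j < n \<and> ps ! i ! j}" using Suc by auto
    have "{l. l < n \<and> ps ! Suc i ! l} = insert j {l. l < n \<and> ps ! i ! l}"
      using j IH(1) by (auto simp: nth_list_update)
    then show ?case using j IH by simp
  qed
  from this[of "length ps - 1"] ne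
  have "length ps - 1 \<le> card {j. j < n \<and> ps ! (length ps - 1) ! j}" by simp
  also have "\<dots> \<le> card {..<n}" by (rule card_mono) auto
  finally show ?thesis by simp
qed

lemma alternation_le_alt:
  assumes "monotone_path n ps"
  shows "alternation f ps \<le> alt n f"
proof -
  have "alternation f qs \<le> Suc n" if "monotone_path n qs" for qs
  proof -
    have "alternation f qs \<le> card {..<length qs}"
      unfolding alternation_def by (rule card_mono) auto
    then show ?thesis using monotone_path_length[OF that] by simp
  qed
  then have "{alternation f qs |qs. monotone_path n qs} \<subseteq> {..Suc n}" by auto
  then have "finite {alternation f qs |qs. monotone_path n qs}" by (rule finite_subset) simp
  then show ?thesis unfolding alt_def using assms by (intro Max_ge) auto
qed

lemma alternates_le_alt:
  assumes "alternates (\<lambda>S. f (point n S)) m A B" "B \<subseteq> {..<n}"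
  shows "m \<le> alt n f"
proof -
  obtain m' where m': "m \<le> m'" "alternates (\<lambda>S. f (point n S)) m' {} {..<n}"
    using alternates_widen[OF assms(1) _ assms(2), of "{}"] by blast
  have "reaches n f m' {..<n}"
    by (rule reaches_alternates[OF m'(2) reaches_empty]) simp
  then obtain ps where "ps \<noteq> []" "hd ps = replicate n False" "last ps = point n {..<n}"
    "\<forall>i. Suc i < length ps \<longrightarrow> (\<exists>j<n. \<not> (ps ! i) ! j \<and> ps ! Suc i = (ps ! i)[j := True])"
    "m' \<le> alternation f ps"
    unfolding reaches_def by blast
  moreover have "point n {..<n} = replicate n True" by (intro nth_equalityI) auto
  ultimately have "monotone_path n ps" "m' \<le> alternation f ps" unfolding monotone_path_def by auto
  then show ?thesis using alternation_le_alt[of n ps f] m'(1) by linarith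
qed

section \<open>Block sensitivity and the final bound\<close>

lemma bs_witness:
  obtains x Bs where "x \<in> cube n"
    "\<And>j. j < bs n f \<Longrightarrow> Bs j \<subseteq> {..<n} \<and> f (flip_block (Bs j) x) \<noteq> f x"
    "disjoint_family_on Bs {..<bs n f}"
proof -
  have "cube n = {x. set x \<subseteq> UNIV \<and> length x = n}" by (simp add: cube_def)
  then have "finite (cube n)" using finite_lists_length_eq[of "UNIV :: bool set" n] by simp
  moreover have "cube n \<noteq> {}" using point_in_cube by blast
  ultimately have "bs n f \<in> bs_at n f ` cube n" unfolding bs_def by (intro Max_in) auto
  then obtain x where x: "x \<in> cube n" "bs n f = bs_at n f x" by blast
  let ?P = "\<lambda>k Bs :: nat \<Rightarrow> nat set.
      (\<forall>j<k. Bs j \<noteq> {} \<and> Bs j \<subseteq> {..<n} \<and> f (flip_block (Bs j) x) \<noteq> f x) \<and>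
      (\<forall>j<k. \<forall>j'<k. j \<noteq> j' \<longrightarrow> Bs j \<inter> Bs j' = {})"
  \<comment> \<open>Disjoint nonempty blocks are at most as many as coordinates, so
    \<open>Max\<close> in \<open>bs_at\<close> is attained.\<close>
  have "k \<le> n" if "?P k Bs" for k Bs
  proof -
    have "disjoint_family_on Bs {..<k}" using that by (simp add: disjoint_family_on_def)
    then have "card {i \<in> {..<k}. Bs i \<inter> {..<n} \<noteq> {}} \<le> n" using card_blocks_hit[of "{..<n}" Bs "{..<k}"] by simp
    moreover have "{i \<in> {..<k}. Bs i \<inter> {..<n} \<noteq> {}} = {..<k}" using that by (auto simp: Int_absorb2)
    ultimately show ?thesis by simp
  qed
  then have "{k. \<exists>Bs. ?P k Bs} \<subseteq> {..n}" by blast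
  then have "finite {k. \<exists>Bs. ?P k Bs}" by (rule finite_subset) simp
  moreover have "0 \<in> {k. \<exists>Bs. ?P k Bs}" by simp
  ultimately have "bs_at n f x \<in> {k. \<exists>Bs. ?P k Bs}" unfolding bs_at_def by (intro Max_in) blast+
  then obtain Bs where "?P (bs n f) Bs" unfolding x(2) by blast
  then show ?thesis using x(1) by (intro that[of x Bs]) (auto simp: disjoint_family_on_def)
qed

text \<open>Optimal blocks at an optimal point, cut into their zero and one coordinates, form a
  sensitive configuration with budget \<open>alt n f\<close>.\<close>

lemma bs_le:
  "bs n f \<le> 2 * alt n f * (4 * max ((Ndeg n f)\<^sup>2) ((Ndeg n (\<lambda>x. \<not> f x))\<^sup>2))"
proof -
  obtain x Bs where x: "x \<in> cube n"
    and Bs: "\<And>j. j < bs n f \<Longrightarrow> Bs j \<subseteq> {..<n} \<and> f (flip_block (Bs j) x) \<noteq> f x"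
    and dis: "disjoint_family_on Bs {..<bs n f}"
    using bs_witness[of n f] by metis
  define X where "X = {i. i < n \<and> x ! i}"
  define U where "U j = Bs j - X" for j
  define W where "W j = Bs j \<inter> X" for j
  have X: "point n X = x" unfolding X_def by (rule point_ones[OF x])
  have "point n (X \<union> U j - W j) = flip_block (Bs j) x" for j
    using x by (intro nth_equalityI) (auto simp: flip_block_def cube_def X_def U_def W_def)
  moreover have "alternates (\<lambda>S. f (point n S)) m (X - \<Union>(W ` {..<bs n f})) (X \<union> \<Union>(U ` {..<bs n f})) \<Longrightarrow> m \<le> alt n f" for m
    by (erule alternates_le_alt) (use Bs in \<open>auto simp: X_def U_def\<close>)
  moreover have "disjoint_family_on U {..<bs n f}" "disjoint_family_on W {..<bs n f}"
    using dis unfolding disjoint_family_on_def U_def W_def by blast+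
  ultimately have "sensitive_config {..<n} (\<lambda>S. f (point n S)) X U W {..<bs n f} (alt n f)"
    unfolding sensitive_config_def using Bs X by (auto simp: X_def U_def W_def)
  from card_sensitive_config_le[OF _ point_interval_bound_Ndeg this] show ?thesis by simp
qed

theorem theorem3p13:
  "\<exists>C::real. \<forall>(n::nat) (f::bool list \<Rightarrow> bool) (k::nat). alt n f = k \<longrightarrow>
     real (bs n f) \<le> C * real k *
       real (max ((Ndeg n f)\<^sup>2) ((Ndeg n (\<lambda>x. \<not> f x))\<^sup>2))"
\<comment> \<open>The constant is the factor \<open>2\<close> from the block count times the factor
  \<open>4\<close> from the interval bound.\<close>
proof (intro exI[of _ 8] allI impI)
  fix n :: nat and f :: "bool list \<Rightarrow> bool" and k :: nat
  assume "alt n f = k"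
  then have "bs n f \<le> 8 * k * max ((Ndeg n f)\<^sup>2) ((Ndeg n (\<lambda>x. \<not> f x))\<^sup>2)"
    using bs_le[of n f] by simp
  then have "real (bs n f) \<le> real (8 * k * max ((Ndeg n f)\<^sup>2) ((Ndeg n (\<lambda>x. \<not> f x))\<^sup>2))"
    by (rule of_nat_mono)
  then show "real (bs n f) \<le> 8 * real k * real (max ((Ndeg n f)\<^sup>2) ((Ndeg n (\<lambda>x. \<not> f x))\<^sup>2))"
    by simp
qed

end
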